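(* Let $d=d(n)\geq 3$ with $dn$ even, and let $\mathbf{G}_n\sim\mathcal{G}_{n,d}$. \begin{itemize} \item There exist a positive sequence $\delta_n=o(1)$ and a constant $c>0$ such that: if $d\leq (2-\delta_n)\ln n/\ln\ln n$, then ${\sf S}(\mathbf{G}_n)\geq c\,n^{1-2/d}$ with probability tending to $1$. \item For every $\delta>0$ there exists $C>0$ such that: if $d>(2+\delta)\ln n/\ln\ln n$, then ${\sf S}(\mathbf{G}_n)\geq n/w$ with probability tending to $1$, where $w$ is the unique solution of the equation $w\ln w=C\ln^2 n/d$. \end{itemize}
   Context: For a graph $G$ and an abelian group $(H,+)$, ${\sf S}_H(G)$ denotes the minimum, over all injections $A:V(G)\to H$, of the cardinality of the set $\{A(u)+A(v):\{u,v\}\in E(G)\}$. Define ${\sf S}(G):=\min_H {\sf S}_H(G)$, the minimum over all abelian groups $H$. $\mathcal{G}_{n,d}$ is the uniform distribution on $d$-regular simple graphs on vertex set $[n]=\{1,\ldots,n\}$; asymptotics are as $n\to\infty$; $\ln$ is the natural logarithm. *)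

theory Defs
  imports
    "HOL-Probability.Probability"
    "HOL-Algebra.Generated_Groups"
    "HOL-Algebra.Elementary_Groups"
begin

text \<open>A simple graph is given by its vertex set \<open>V\<close> and its edge set \<open>E\<close>, a set of two-element
  subsets of \<open>V\<close>. Abelian groups are commutative groups of HOL-Algebra, which are written
  multiplicatively.\<close>

definition labellings :: "('h, 'm) monoid_scheme \<Rightarrow> 'v set \<Rightarrow> ('v \<Rightarrow> 'h) set" where
  "labellings H V = {A. A \<in> V \<rightarrow> carrier H \<and> inj_on A V}"

definition edge_sums :: "('h, 'm) monoid_scheme \<Rightarrow> 'v set set \<Rightarrow> ('v \<Rightarrow> 'h) \<Rightarrow> 'h set" where
  "edge_sums H E A = {A u \<otimes>\<^bsub>H\<^esub> A v | u v. {u, v} \<in> E}"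

text \<open>On the natural numbers \<open>INF\<close> is the minimum of a nonempty set, but \<open>0\<close> for the empty set:
  \<open>sum_number_in H V E\<close> is meaningful only if \<open>H\<close> is large enough to label \<open>V\<close>.\<close>

definition sum_number_in :: "('h, 'm) monoid_scheme \<Rightarrow> 'v set \<Rightarrow> 'v set set \<Rightarrow> nat" where
  "sum_number_in H V E = (INF A \<in> labellings H V. card (edge_sums H E A))"

text \<open>The minimum ranges over the abelian groups in which \<open>V\<close> can be labelled. HOL cannot
  quantify over all types, so the carriers are sets of natural numbers. This loses no generality,
  since the labels generate a countable group: \<open>sum_number_le\<close> below covers abelian groups over
  every type.\<close>

definition sum_number :: "'v set \<Rightarrow> 'v set set \<Rightarrow> nat" where
  "sum_number V E =
     (INF H \<in> {H :: nat monoid. comm_group H \<and> labellings H V \<noteq> {}}. sum_number_in H V E)"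

lemma countable_generate:
  assumes "group H" "countable X" "X \<subseteq> carrier H"
  shows "countable (generate H X)"
proof -
  interpret group H by fact
  define L where "L = lists (X \<union> (\<lambda>x. inv\<^bsub>H\<^esub> x) ` X)"
  define m where "m = (\<lambda>xs. foldr (\<otimes>\<^bsub>H\<^esub>) xs \<one>\<^bsub>H\<^esub>)"
  have sub: "X \<union> (\<lambda>x. inv\<^bsub>H\<^esub> x) ` X \<subseteq> carrier H"
    using assms(3) by auto
  have mc: "m xs \<in> carrier H" if "set xs \<subseteq> carrier H" for xs
    using that unfolding m_def by (induction xs) auto
  have app: "m (xs @ ys) = m xs \<otimes>\<^bsub>H\<^esub> m ys"
    if "set xs \<subseteq> carrier H" "set ys \<subseteq> carrier H" for xs ys
    using that(1)
  proof (induction xs)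
    case Nil
    show ?case using mc[OF that(2)] by (simp add: m_def)
  next
    case (Cons a xs)
    then have "m (xs @ ys) = m xs \<otimes>\<^bsub>H\<^esub> m ys" "m xs \<in> carrier H" "a \<in> carrier H"
      using mc[of xs] by auto
    then show ?case using mc[OF that(2)] by (simp add: m_def m_assoc)
  qed
  have LC: "set xs \<subseteq> carrier H" if "xs \<in> L" for xs
    using that sub unfolding L_def by blast
  have "generate H X \<subseteq> m ` L"
  proof
    fix h assume "h \<in> generate H X"
    then show "h \<in> m ` L"
    proof (induction rule: generate.induct)
      case one
      have "m [] = \<one>\<^bsub>H\<^esub>" "[] \<in> L" by (auto simp: m_def L_def)
      then show ?case by (metis image_eqI)
    next
      case (incl h)
      have "m [h] = h" "[h] \<in> L" using incl assms(3) by (auto simp: m_def L_def)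
      then show ?case by (metis image_eqI)
    next
      case (inv h)
      have "m [inv\<^bsub>H\<^esub> h] = inv\<^bsub>H\<^esub> h" "[inv\<^bsub>H\<^esub> h] \<in> L"
        using inv assms(3) by (auto simp: m_def L_def)
      then show ?case by (metis image_eqI)
    next
      case (eng h1 h2)
      then obtain xs ys where "xs \<in> L" "h1 = m xs" "ys \<in> L" "h2 = m ys" by blast
      moreover from this have "m (xs @ ys) = h1 \<otimes>\<^bsub>H\<^esub> h2" using app LC by blast
      moreover have "xs @ ys \<in> L" using \<open>xs \<in> L\<close> \<open>ys \<in> L\<close> by (simp add: L_def)
      ultimately show ?case by (metis image_eqI)
    qed
  qed
  moreover have "countable L" unfolding L_def using assms(2) by auto
  ultimately show ?thesis by (meson countable_image countable_subset)
qed

lemma transfer_labelling: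
  fixes H :: "('h, 'm) monoid_scheme"
  assumes H: "comm_group H" and V: "finite V" and E: "\<And>e. e \<in> E \<Longrightarrow> e \<subseteq> V"
    and A: "A \<in> labellings H V"
  obtains H' :: "nat monoid" and A' where "comm_group H'" "A' \<in> labellings H' V"
    "card (edge_sums H' E A') = card (edge_sums H E A)"
proof -
  interpret comm_group H by fact
  have AC: "A ` V \<subseteq> carrier H" and Ainj: "inj_on A V" using A by (auto simp: labellings_def)
  define K where "K = generate H (A ` V)"
  have K: "subgroup K H" unfolding K_def by (rule generate_is_subgroup[OF AC])
  have cK: "countable K"
    unfolding K_def by (rule countable_generate[OF is_group _ AC]) (simp add: V countable_finite)
  define f where "f = to_nat_on K"
  define g where "g = inv_into K f"
  have finj: "inj_on f K" unfolding f_def by (rule inj_on_to_nat_on[OF cK])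
  have gf: "g (f x) = x" if "x \<in> K" for x
    unfolding g_def using inv_into_f_f[OF finj that] .
  have AK: "A v \<in> K" if "v \<in> V" for v
    unfolding K_def by (rule generate.incl) (rule imageI[OF that])
  have KC: "x \<in> carrier H" if "x \<in> K" for x
    by (rule subgroup.mem_carrier[OF K that])
  have Km: "x \<otimes>\<^bsub>H\<^esub> y \<in> K" if "x \<in> K" "y \<in> K" for x y
    by (rule subgroup.m_closed[OF K that])
  have K1: "\<one>\<^bsub>H\<^esub> \<in> K" by (rule subgroup.one_closed[OF K])
  have Ki: "inv\<^bsub>H\<^esub> x \<in> K" if "x \<in> K" for x
    by (rule subgroup.m_inv_closed[OF K that])
  define H' where "H' = \<lparr>carrier = f ` K, monoid.mult = (\<lambda>x y. f (g x \<otimes>\<^bsub>H\<^esub> g y)), one = f \<one>\<^bsub>H\<^esub>\<rparr>"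
  have cg: "comm_group H'"
  proof (rule comm_groupI)
    fix x assume "x \<in> carrier H'"
    then obtain a where a: "a \<in> K" "x = f a" by (auto simp: H'_def)
    then have "f (inv\<^bsub>H\<^esub> a) \<otimes>\<^bsub>H'\<^esub> x = \<one>\<^bsub>H'\<^esub>" "f (inv\<^bsub>H\<^esub> a) \<in> carrier H'"
      by (auto simp: H'_def gf Ki KC)
    then show "\<exists>y\<in>carrier H'. y \<otimes>\<^bsub>H'\<^esub> x = \<one>\<^bsub>H'\<^esub>" by blast
  qed (auto simp: H'_def gf Km K1 KC m_assoc m_comm m_lcomm)
  moreover have lab: "f \<circ> A \<in> labellings H' V"
    using AK Ainj finj unfolding labellings_def H'_def
    by (auto intro!: comp_inj_on intro: inj_on_subset)
  moreover have "edge_sums H' E (f \<circ> A) = f ` edge_sums H E A"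
  proof -
    have *: "(f \<circ> A) u \<otimes>\<^bsub>H'\<^esub> (f \<circ> A) v = f (A u \<otimes>\<^bsub>H\<^esub> A v)" if "{u, v} \<in> E" for u v
      using E[OF that] by (simp add: H'_def gf AK)
    show ?thesis
    proof
      show "edge_sums H' E (f \<circ> A) \<subseteq> f ` edge_sums H E A"
        unfolding edge_sums_def using * by blast
      show "f ` edge_sums H E A \<subseteq> edge_sums H' E (f \<circ> A)"
      proof
        fix y assume "y \<in> f ` edge_sums H E A"
        then obtain u v where uv: "{u, v} \<in> E" "y = f (A u \<otimes>\<^bsub>H\<^esub> A v)"
          unfolding edge_sums_def by blast
        then have "y = (f \<circ> A) u \<otimes>\<^bsub>H'\<^esub> (f \<circ> A) v" using *[OF uv(1)] by simp
        then show "y \<in> edge_sums H' E (f \<circ> A)" unfolding edge_sums_def using uv(1) by blast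
      qed
    qed
  qed
  moreover have "edge_sums H E A \<subseteq> K"
    unfolding edge_sums_def using E by (auto intro!: Km AK)
  ultimately show ?thesis
    using that[of H' "f \<circ> A"] by (metis card_image finj inj_on_subset)
qed

theorem sum_number_le:
  fixes H :: "('h, 'm) monoid_scheme"
  assumes "comm_group H" "finite V" "\<And>e. e \<in> E \<Longrightarrow> e \<subseteq> V" "A \<in> labellings H V"
  shows "sum_number V E \<le> card (edge_sums H E A)"
proof -
  obtain H' :: "nat monoid" and A' where H': "comm_group H'" and A': "A' \<in> labellings H' V"
    and eq: "card (edge_sums H' E A') = card (edge_sums H E A)"
    using transfer_labelling[OF assms] by metis
  have "sum_number V E \<le> sum_number_in H' V E"
    unfolding sum_number_def using H' A' by (intro cINF_lower) auto
  also have "\<dots> \<le> card (edge_sums H' E A')"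
    unfolding sum_number_in_def using A' by (intro cINF_lower) auto
  finally show ?thesis using eq by simp
qed

theorem sum_number_attained:
  assumes "finite V" "\<And>e. e \<in> E \<Longrightarrow> e \<subseteq> V"
  obtains H :: "nat monoid" and A where "comm_group H" "A \<in> labellings H V"
    "sum_number V E = card (edge_sums H E A)"
proof -
  obtain f :: "'a \<Rightarrow> nat" where f: "inj_on f V"
    using finite_imp_inj_to_nat_seg[OF assms(1)] by metis
  then have "int \<circ> f \<in> labellings integer_group V"
    by (auto simp: labellings_def inj_on_def)
  moreover have "comm_group integer_group"
    by (rule group.group_comm_groupI) auto
  ultimately obtain H0 :: "nat monoid" where "comm_group H0" "labellings H0 V \<noteq> {}"
    using transfer_labelling[of integer_group V E "int \<circ> f"] assms by (metis empty_iff)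
  then have ne: "{H :: nat monoid. comm_group H \<and> labellings H V \<noteq> {}} \<noteq> {}" by blast
  have "sum_number V E \<in> (\<lambda>H. sum_number_in H V E) ` {H :: nat monoid. comm_group H \<and> labellings H V \<noteq> {}}"
    unfolding sum_number_def using ne by (intro Inf_nat_def1) blast
  then obtain H :: "nat monoid" where H: "comm_group H" "labellings H V \<noteq> {}"
    "sum_number V E = sum_number_in H V E" by auto
  have "sum_number_in H V E \<in> (\<lambda>A. card (edge_sums H E A)) ` labellings H V"
    unfolding sum_number_in_def using H(2) by (intro Inf_nat_def1) blast
  then show ?thesis using that H by auto
qed

text \<open>Edge sets of the \<open>d\<close>-regular simple graphs on \<open>[n]\<close>.\<close>

definition regular_graphs :: "nat \<Rightarrow> nat \<Rightarrow> nat set set set" where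
  "regular_graphs n d =
     {E. E \<subseteq> {e. e \<subseteq> {1..n} \<and> card e = 2} \<and> (\<forall>v\<in>{1..n}. card {e \<in> E. v \<in> e} = d)}"

lemma finite_regular_graphs: "finite (regular_graphs n d)"
  by (rule finite_subset[of _ "Pow (Pow {1..n})"]) (auto simp: regular_graphs_def)

text \<open>\<open>pmf_of_set\<close> is specified for nonempty sets only; such graphs exist when \<open>d < n\<close> and \<open>d * n\<close>
  is even.\<close>

definition random_regular_graph :: "nat \<Rightarrow> nat \<Rightarrow> nat set set pmf" where
  "random_regular_graph n d = pmf_of_set (regular_graphs n d)"

text \<open>\<open>P n\<close> holds for the random \<open>d n\<close>-regular graph on \<open>[n]\<close> with probability tending to \<open>1\<close> as
  \<open>n\<close> tends to infinity within \<open>N\<close>. Restricting \<open>n\<close> to a set is needed because, for example, for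
  constant odd \<open>d\<close> the model exists only for even \<open>n\<close>.\<close>

definition whp_regular :: "nat set \<Rightarrow> (nat \<Rightarrow> nat) \<Rightarrow> (nat \<Rightarrow> nat set set \<Rightarrow> bool) \<Rightarrow> bool" where
  "whp_regular N d P \<longleftrightarrow>
     ((\<lambda>n. measure_pmf.prob (random_regular_graph n (d n)) {E. P n E}) \<longlongrightarrow> 1)
       (inf sequentially (principal N))"

text \<open>Logarithms of nonpositive reals are junk values, hence the explicit \<open>w > 0\<close>.\<close>

definition w_sol :: "real \<Rightarrow> nat \<Rightarrow> nat \<Rightarrow> real" where
  "w_sol C n d = (THE w. w > 0 \<and> w * ln w = C * (ln (real n))\<^sup>2 / real d)"

lemma xlnx_unique:
  fixes y :: real
  assumes "y > 0"
  shows "\<exists>!w. w > 0 \<and> w * ln w = y"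
proof -
  have gt1: "w > 1" if "w > 0" "w * ln w = y" for w
  proof -
    have "ln w > 0" using that assms zero_less_mult_pos[of w "ln w"] by simp
    then show ?thesis using that(1) ln_gt_zero_iff[of w] by simp
  qed
  have mono: "v * ln v < w * ln w" if "1 < v" "v < w" for v w :: real
    using that by (intro mult_strict_mono) auto
  have "\<exists>w\<ge>1. w \<le> exp 1 + y \<and> w * ln w = y"
  proof (rule IVT')
    have pos: "0 < exp 1 + y" using assms exp_gt_zero[of "1::real"] by linarith
    then have "1 \<le> ln (exp 1 + y)" using assms by (simp add: ln_ge_iff)
    with pos have "(exp 1 + y) * 1 \<le> (exp 1 + y) * ln (exp 1 + y)"
      by (intro mult_left_mono) auto
    moreover have "y \<le> (exp 1 + y) * 1" by simp
    ultimately show "y \<le> (exp 1 + y) * ln (exp 1 + y)" by (rule order_trans[rotated])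
    show "1 \<le> exp 1 + y" using one_le_exp_iff[of "1::real"] assms by linarith
    show "continuous_on {1..exp 1 + y} (\<lambda>w. w * ln w)" by (intro continuous_intros) auto
  qed (use assms in auto)
  then obtain w where w: "w \<ge> 1" "w * ln w = y" by blast
  show ?thesis
  proof (rule ex1I[of _ w])
    show "w > 0 \<and> w * ln w = y" using w by simp
  next
    fix v assume v: "v > 0 \<and> v * ln v = y"
    then have "v > 1" "w > 1" using gt1[of v] gt1[of w] w by auto
    then show "v = w" using mono[of v w] mono[of w v] v w by (cases v w rule: linorder_cases) auto
  qed
qed

lemma w_sol:
  assumes "C > 0" "n \<ge> 2" "d > 0"
  shows "w_sol C n d > 0" "w_sol C n d * ln (w_sol C n d) = C * (ln (real n))\<^sup>2 / real d"
proof -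
  have "C * (ln (real n))\<^sup>2 / real d > 0" using assms by auto
  from theI'[OF xlnx_unique[OF this]]
  show "w_sol C n d > 0" "w_sol C n d * ln (w_sol C n d) = C * (ln (real n))\<^sup>2 / real d"
    unfolding w_sol_def by auto
qed

end

theory Submission
  imports Defs "HOL-Library.Function_Algebras" "HOL-Algebra.FiniteProduct" "HOL-Real_Asymp.Real_Asymp"
begin

text \<open>A first-moment argument. Write \<open>m = n d / 2\<close> and \<open>N = n (n - 1) / 2\<close>. Among all degree sequences
  with a given sum the regular one is realised by the most graphs, and there are at most
  \<open>(e (d + 1))^n\<close> such sequences, so there are at least \<open>(N choose m) / (e (d + 1))^n\<close> regular graphs.

  If \<open>A\<close> labels \<open>G\<close> with at most \<open>K\<close> edge sums, then \<open>G\<close> lies in the graph of all pairs \<open>u, v\<close> for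
  which \<open>A u + A v\<close> is one of these sums; since \<open>A\<close> is injective, it has maximum degree at most \<open>K\<close>.
  Along a spanning forest of polylogarithmic depth whose edges are coloured by their sums, every label
  is a short integer combination of the \<open>K\<close> sums and of the labels of the roots. The big graph is
  therefore determined by the forest, its colours and by which short integer vectors are relations
  in the group. A set of relations that is cut out of a finite set by a subgroup is determined by a maximal
  dissociated subset; as all the subset sums of a dissociated set are distinct, such a set has only
  \<open>O((K + #roots) ln ln n)\<close> elements. Up to \<open>exp (O(K ln n ln ln n))\<close> this leaves
  \<open>(n K)^n (N choose (m - n)) (K / n)^(m - n)\<close> graphs with small sum number, which is compared with the number of
  regular graphs. A component that is too small to afford a root of its own is instead replaced by a clique,
  so that no connectivity of the random graph is needed.\<close>

section \<open>Graphs with given degrees\<close>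

text \<open>Rankin's trick: expanding the power into a sum of products over all functions, every
  member of \<open>S\<close> alone contributes at least \<open>\<tau>\<close>. It serves twice, for
  degree sequences and for subset sums.\<close>

lemma card_PiE_le_weight:
  fixes g :: "'b \<Rightarrow> real"
  assumes "finite I" "finite J" "S \<subseteq> I \<rightarrow>\<^sub>E J" "\<And>j. j \<in> J \<Longrightarrow> 0 \<le> g j"
    and "\<And>x. x \<in> S \<Longrightarrow> \<tau> \<le> (\<Prod>i\<in>I. g (x i))"
  shows "real (card S) * \<tau> \<le> (\<Sum>j\<in>J. g j) ^ card I"
proof -
  have fin: "finite (I \<rightarrow>\<^sub>E J)" using assms by (intro finite_PiE) auto
  have "real (card S) * \<tau> = (\<Sum>x\<in>S. \<tau>)" by simp
  also have "\<dots> \<le> (\<Sum>x\<in>S. \<Prod>i\<in>I. g (x i))" by (intro sum_mono assms)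
  also have "\<dots> \<le> (\<Sum>x\<in>I \<rightarrow>\<^sub>E J. \<Prod>i\<in>I. g (x i))"
    using assms by (intro sum_mono2 fin prod_nonneg) auto
  also have "\<dots> = (\<Prod>i\<in>I. \<Sum>j\<in>J. g j)"
    using assms by (intro prod_sum_PiE[symmetric]) auto
  finally show ?thesis by simp
qed

section \<open>Simple graphs and their degrees\<close>

definition pairs :: "'a set \<Rightarrow> 'a set set" where
  "pairs V = {e. e \<subseteq> V \<and> card e = 2}"

definition deg :: "'a set set \<Rightarrow> 'a \<Rightarrow> nat" where
  "deg E v = card {e \<in> E. v \<in> e}"

definition degree_class :: "'a set \<Rightarrow> ('a \<Rightarrow> nat) \<Rightarrow> 'a set set set" where
  "degree_class V f = {E. E \<subseteq> pairs V \<and> (\<forall>v\<in>V. deg E v = f v)}"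

lemma finite_pairs: "finite V \<Longrightarrow> finite (pairs V)"
  by (rule finite_subset[of _ "Pow V"]) (auto simp: pairs_def)

lemma card_pairs: "finite V \<Longrightarrow> card (pairs V) = card V choose 2"
  unfolding pairs_def by (rule n_subsets)

lemma finite_degree_class: "finite V \<Longrightarrow> finite (degree_class V f)"
  by (rule finite_subset[of _ "Pow (pairs V)"]) (auto simp: degree_class_def finite_pairs)

lemma pairs_iff: "{u, v} \<in> pairs V \<longleftrightarrow> u \<in> V \<and> v \<in> V \<and> u \<noteq> v"
  by (auto simp: pairs_def card_insert_if)

lemma pairs_elim:
  assumes "e \<in> pairs V" obtains u v where "e = {u, v}" "u \<in> V" "v \<in> V" "u \<noteq> v"
  using assms by (auto simp: pairs_def card_2_iff)

lemma sum_deg: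
  assumes "finite V" "E \<subseteq> pairs V"
  shows "(\<Sum>v\<in>V. deg E v) = 2 * card E"
proof -
  have fE: "finite E" using assms finite_pairs finite_subset by metis
  have "(\<Sum>v\<in>V. deg E v) = (\<Sum>v\<in>V. \<Sum>e\<in>E. if v \<in> e then 1 else 0)"
    unfolding deg_def using fE by (simp add: sum.If_cases Int_def)
  also have "\<dots> = (\<Sum>e\<in>E. \<Sum>v\<in>V. if v \<in> e then 1 else 0)" by (rule sum.swap)
  also have "\<dots> = (\<Sum>e\<in>E. 2)"
  proof (rule sum.cong)
    fix e assume "e \<in> E"
    then have "e \<subseteq> V" "card e = 2" using assms by (auto simp: pairs_def)
    then show "(\<Sum>v\<in>V. if v \<in> e then 1 else 0) = (2::nat)"
      using assms by (simp add: sum.If_cases Int_absorb1)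
  qed simp
  finally show ?thesis by simp
qed

lemma deg_card_neighbours:
  assumes "E \<subseteq> pairs V"
  shows "deg E v = card {w. {v, w} \<in> E}"
  unfolding deg_def
proof (rule bij_betw_same_card[symmetric])
  show "bij_betw (\<lambda>w. {v, w}) {w. {v, w} \<in> E} {e \<in> E. v \<in> e}"
    unfolding bij_betw_def
  proof
    show "inj_on (\<lambda>w. {v, w}) {w. {v, w} \<in> E}" by (auto simp: inj_on_def doubleton_eq_iff)
    show "(\<lambda>w. {v, w}) ` {w. {v, w} \<in> E} = {e \<in> E. v \<in> e}"
    proof
      show "{e \<in> E. v \<in> e} \<subseteq> (\<lambda>w. {v, w}) ` {w. {v, w} \<in> E}"
      proof
        fix e assume e: "e \<in> {e \<in> E. v \<in> e}"
        then have "e \<in> pairs V" using assms by auto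
        then obtain a b where "e = {a, b}" by (rule pairs_elim)
        then show "e \<in> (\<lambda>w. {v, w}) ` {w. {v, w} \<in> E}" using e by (auto simp: insert_commute)
      qed
    qed auto
  qed
qed

section \<open>Redirecting one edge from a vertex to another\<close>

definition private_nbrs :: "'a set set \<Rightarrow> 'a \<Rightarrow> 'a \<Rightarrow> 'a set" where
  "private_nbrs E i j = {w. {i, w} \<in> E \<and> {j, w} \<notin> E \<and> w \<noteq> j}"

definition move_edge :: "'a \<Rightarrow> 'a \<Rightarrow> 'a \<Rightarrow> 'a set set \<Rightarrow> 'a set set" where
  "move_edge i j w E = insert {j, w} (E - {{i, w}})"

text \<open>\<open>private_nbrs E i j\<close> collects the \<open>w\<close> whose edge to
  \<open>i\<close> can be redirected to \<open>j\<close> without creating a loop or a double edge.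
  Common neighbours and a possible edge between \<open>i\<close> and \<open>j\<close> count equally
  in both degrees, so the degrees differ exactly as the numbers of private neighbours do.\<close>

lemma private_nbrs_card:
  assumes "finite V" "E \<subseteq> pairs V" "i \<noteq> j"
  shows "deg E i + card (private_nbrs E j i) = deg E j + card (private_nbrs E i j)"
proof -
  define N where "N = (\<lambda>v. {w. {v, w} \<in> E})"
  have sub: "N v \<subseteq> V" for v using assms(2) by (auto simp: N_def pairs_def)
  then have fin: "finite (N v)" for v using assms(1) finite_subset by blast
  have split: "card (N i) = card (N i \<inter> N j) + card (N i \<inter> {j}) + card (private_nbrs E i j)"
    if "i \<noteq> j" for i j
  proof -
    have jj: "j \<notin> N j" using assms(2) by (auto simp: N_def pairs_def)
    have "N i = (N i \<inter> N j \<union> (N i \<inter> {j})) \<union> private_nbrs E i j"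
      by (auto simp: N_def private_nbrs_def)
    moreover have "card ((N i \<inter> N j \<union> (N i \<inter> {j})) \<union> private_nbrs E i j)
        = card (N i \<inter> N j \<union> (N i \<inter> {j})) + card (private_nbrs E i j)"
      using fin[of i] jj by (intro card_Un_disjoint) (auto simp: N_def private_nbrs_def intro: finite_subset[of _ "{w. {i, w} \<in> E}"])
    moreover have "card (N i \<inter> N j \<union> (N i \<inter> {j})) = card (N i \<inter> N j) + card (N i \<inter> {j})"
      using fin jj by (intro card_Un_disjoint) auto
    ultimately show ?thesis by simp
  qed
  have "(j \<in> N i) = (i \<in> N j)" by (auto simp: N_def insert_commute)
  then have "card (N i \<inter> {j}) = card (N j \<inter> {i})" by (cases "j \<in> N i") auto
  then show ?thesis
    using split[of i j] split[of j i] assms(3) deg_card_neighbours[OF assms(2)]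
    by (simp add: N_def Int_commute)
qed

lemma move_edge_pairs:
  assumes "E \<subseteq> pairs V" "i \<in> V" "j \<in> V" "w \<in> private_nbrs E i j"
  shows "move_edge i j w E \<subseteq> pairs V"
proof -
  have "w \<in> V" using assms by (auto simp: private_nbrs_def pairs_def)
  then have "{j, w} \<in> pairs V" using assms by (auto simp: pairs_iff private_nbrs_def)
  then show ?thesis using assms by (auto simp: move_edge_def)
qed

text \<open>The move is undone by the reverse move, and \<open>w\<close> is the only private
  neighbour that \<open>j\<close> gains. This turns moves into a bijection between pairs of a graph
  and a private neighbour.\<close>

lemma private_nbrs_move_edge:
  assumes "E \<subseteq> pairs V" "i \<noteq> j" "w \<in> private_nbrs E i j"
  shows "private_nbrs (move_edge i j w E) j i = insert w (private_nbrs E j i)"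
    and "w \<notin> private_nbrs E j i"
    and "move_edge j i w (move_edge i j w E) = E"
proof -
  have w: "w \<noteq> i" "w \<noteq> j" "{i, w} \<in> E" "{j, w} \<notin> E" using assms by (auto simp: private_nbrs_def pairs_def)
  show "private_nbrs (move_edge i j w E) j i = insert w (private_nbrs E j i)"
    using w assms(2) by (auto simp: private_nbrs_def move_edge_def doubleton_eq_iff)
  show "w \<notin> private_nbrs E j i" using w by (auto simp: private_nbrs_def)
  show "move_edge j i w (move_edge i j w E) = E"
    using w by (auto simp: move_edge_def)
qed

lemma deg_move_edge:
  assumes "finite V" "E \<subseteq> pairs V" "i \<noteq> j" "w \<in> private_nbrs E i j"
  shows "deg (move_edge i j w E) v = ((deg E)(i := deg E i - 1, j := deg E j + 1)) v"
proof -
  have fE: "finite E" using assms finite_pairs finite_subset by metis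
  have w: "w \<noteq> i" "w \<noteq> j" "{i, w} \<in> E" "{j, w} \<notin> E" using assms by (auto simp: private_nbrs_def pairs_def)
  define S where "S = {e \<in> E. v \<in> e}"
  have fS: "finite S" using fE by (simp add: S_def)
  have *: "{e \<in> move_edge i j w E. v \<in> e} =
     (if v \<in> {j, w} then insert {j, w} else id) (if v \<in> {i, w} then S - {{i, w}} else S)"
    using w by (auto simp: move_edge_def S_def)
  have inS: "v \<in> {i, w} \<Longrightarrow> {i, w} \<in> S" "{j, w} \<notin> S" using w by (auto simp: S_def)
  have pos: "v \<in> {i, w} \<Longrightarrow> card S > 0" using inS fS card_gt_0_iff by blast
  show ?thesis
  proof -
    have dv: "deg E v = card S" by (simp add: deg_def S_def)
    consider "v = i" | "v = j" | "v = w" | "v \<noteq> i" "v \<noteq> j" "v \<noteq> w" by blast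
    then show ?thesis
      unfolding deg_def[of "move_edge i j w E"] * using w assms(3) inS fS pos dv
      by cases (simp_all add: card_Diff_singleton)
  qed
qed

text \<open>Moving an edge from \<open>i\<close> to \<open>j\<close> relates the two classes; every \<open>E\<close> in the first has more such
  moves than each of its images has inverse moves.\<close>

lemma card_degree_class_balance:
  assumes V: "finite V" and ij: "i \<in> V" "j \<in> V" "f i \<ge> f j + 2"
  shows "card (degree_class V f) \<le> card (degree_class V (f(i := f i - 1, j := f j + 1)))"
proof -
  define f' where "f' = f(i := f i - 1, j := f j + 1)"
  have ne: "i \<noteq> j" using ij by auto
  define a where "a = (\<lambda>E. private_nbrs E i j)"
  define b where "b = (\<lambda>E. private_nbrs E j i)"
  have fin: "finite (a E)" "finite (b E)" if "E \<subseteq> pairs V" for E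
    using that by (auto intro!: finite_subset[OF _ V] simp: a_def b_def private_nbrs_def pairs_def)
  \<comment> \<open>The move enlarges \<open>b\<close> by one element, whereas the degree gap of at
    least 2 makes \<open>a E\<close> larger than \<open>b E\<close> by at least 2.\<close>
  have *: "move_edge i j w E \<in> degree_class V f' \<and> w \<in> b (move_edge i j w E) \<and> card (b (move_edge i j w E)) \<le> card (a E)"
    if "E \<in> degree_class V f" "w \<in> a E" for E w
  proof -
    have E: "E \<subseteq> pairs V" and d: "\<And>v. v \<in> V \<Longrightarrow> deg E v = f v" using that by (auto simp: degree_class_def)
    have w: "w \<in> private_nbrs E i j" using that by (simp add: a_def)
    have "move_edge i j w E \<in> degree_class V f'"
      using move_edge_pairs[OF E ij(1,2) w] deg_move_edge[OF V E ne w] d ij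
      by (auto simp: degree_class_def f'_def)
    moreover have "card (b E) + 2 \<le> card (a E)"
      using private_nbrs_card[OF V E ne] d ij by (simp add: a_def b_def)
    ultimately show ?thesis
      using private_nbrs_move_edge[OF E ne w] fin[OF E] by (simp add: b_def)
  qed
  have **: "move_edge j i w E \<in> degree_class V f \<and> w \<in> a (move_edge j i w E)"
    if "E \<in> degree_class V f'" "w \<in> b E" for E w
  proof -
    have E: "E \<subseteq> pairs V" and d: "\<And>v. v \<in> V \<Longrightarrow> deg E v = f' v" using that by (auto simp: degree_class_def)
    have w: "w \<in> private_nbrs E j i" using that by (simp add: b_def)
    have "move_edge j i w E \<in> degree_class V f"
      using move_edge_pairs[OF E ij(2,1) w] deg_move_edge[OF V E ne[symmetric] w] d ij
      by (auto simp: degree_class_def f'_def)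
    then show ?thesis
      using private_nbrs_move_edge[OF E ne[symmetric] w] by (simp add: a_def)
  qed
  \<comment> \<open>Each graph spreads mass 1 evenly over its moves. By \<open>*\<close> the mass of
    a move does not decrease when it is reweighted by the number of inverse moves at the image, and
    there the masses add up to at most 1.\<close>
  have "real (card (degree_class V f)) = (\<Sum>E\<in>degree_class V f. \<Sum>w\<in>a E. 1 / real (card (a E)))"
  proof -
    have "(\<Sum>w\<in>a E. 1 / real (card (a E))) = 1" if "E \<in> degree_class V f" for E
    proof -
      have E: "E \<subseteq> pairs V" and d: "\<And>v. v \<in> V \<Longrightarrow> deg E v = f v" using that by (auto simp: degree_class_def)
      have "card (b E) + 2 \<le> card (a E)"
        using private_nbrs_card[OF V E ne] d ij by (simp add: a_def b_def)
      then show ?thesis by (simp add: a_def)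
    qed
    then show ?thesis by simp
  qed
  also have "\<dots> = (\<Sum>(E, w)\<in>Sigma (degree_class V f) a. 1 / real (card (a E)))"
    by (subst sum.Sigma[OF finite_degree_class[OF V]]) (use fin in \<open>auto simp: degree_class_def\<close>)
  also have "\<dots> \<le> (\<Sum>(E, w)\<in>Sigma (degree_class V f) a. 1 / real (card (b (move_edge i j w E))))"
  proof (intro sum_mono, clarify)
    fix E w assume Ew: "E \<in> degree_class V f" "w \<in> a E"
    have "move_edge i j w E \<subseteq> pairs V" using *[OF Ew] by (simp add: degree_class_def)
    then have "card (b (move_edge i j w E)) > 0" using *[OF Ew] fin(2) card_gt_0_iff by blast
    then show "1 / real (card (a E)) \<le> 1 / real (card (b (move_edge i j w E)))"
      using *[OF Ew] by (simp add: frac_le)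
  qed
  also have "\<dots> = (\<Sum>(E, w)\<in>Sigma (degree_class V f') b. 1 / real (card (b E)))"
  proof (rule sum.reindex_bij_witness[of _ "\<lambda>(E, w). (move_edge j i w E, w)" "\<lambda>(E, w). (move_edge i j w E, w)"], goal_cases)
    case (1 x)
    then show ?case using private_nbrs_move_edge(3)[of "fst x" V i j "snd x"] ne
      by (auto simp: degree_class_def a_def)
  next
    case (3 x)
    then show ?case using private_nbrs_move_edge(3)[of "fst x" V j i "snd x"] ne
      by (auto simp: degree_class_def b_def)
  next
    case (2 x)
    then show ?case using *[of "fst x" "snd x"] by auto
  next
    case (4 x)
    then show ?case using **[of "fst x" "snd x"] by auto
  next
    case (5 x)
    then show ?case by (simp add: case_prod_beta)
  qed
  also have "\<dots> = (\<Sum>E\<in>degree_class V f'. \<Sum>w\<in>b E. 1 / real (card (b E)))"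
    by (subst sum.Sigma[OF finite_degree_class[OF V]]) (use fin in \<open>auto simp: degree_class_def\<close>)
  \<comment> \<open>Only an inequality, since a graph with empty \<open>b E\<close> contributes
    0.\<close>
  also have "\<dots> \<le> (\<Sum>E\<in>degree_class V f'. 1)"
    by (intro sum_mono) (simp add: divide_simps)
  finally show ?thesis unfolding f'_def by simp
qed

text \<open>Induction on the total excess over \<open>d\<close>; truncated subtraction ignores the
  deficits. A nonconstant sequence with average \<open>d\<close> has an entry above and an entry
  below \<open>d\<close>. These differ by at least 2, so the balancing lemma applies, and moving one
  unit lowers the excess.\<close>

lemma card_degree_class_le_regular:
  assumes V: "finite V" and "(\<Sum>v\<in>V. f v) = card V * d"
  shows "card (degree_class V f) \<le> card (degree_class V (\<lambda>_. d))"
  using assms(2)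
proof (induction "\<Sum>v\<in>V. f v - d" arbitrary: f rule: less_induct)
  case less
  show ?case
  proof (cases "\<forall>v\<in>V. f v = d")
    case True
    then show ?thesis by (simp add: degree_class_def)
  next
    case False
    have i: "\<exists>i\<in>V. f i > d"
    proof (rule ccontr)
      assume "\<not> ?thesis"
      then have "\<forall>v\<in>V. f v \<le> d" "\<exists>v\<in>V. f v < d" using False by (auto simp: not_less le_less)
      then have "(\<Sum>v\<in>V. f v) < (\<Sum>v\<in>V. d)" by (intro sum_strict_mono_ex1 V) auto
      then show False using less.prems by simp
    qed
    have j: "\<exists>i\<in>V. f i < d"
    proof (rule ccontr)
      assume "\<not> ?thesis"
      then have "\<forall>v\<in>V. d \<le> f v" "\<exists>v\<in>V. d < f v" using False by (auto simp: not_less le_less)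
      then have "(\<Sum>v\<in>V. d) < (\<Sum>v\<in>V. f v)" by (intro sum_strict_mono_ex1 V) auto
      then show False using less.prems by simp
    qed
    obtain i j where ij: "i \<in> V" "j \<in> V" "f i > d" "f j < d" using i j by auto
    define f' where "f' = f(i := f i - 1, j := f j + 1)"
    have ne: "i \<noteq> j" using ij by auto
    have rm: "(\<Sum>v\<in>V. g v) = g i + g j + (\<Sum>v\<in>V - {i} - {j}. g v)" for g :: "'a \<Rightarrow> nat"
      using ij ne V by (simp add: sum.remove[of V i] sum.remove[of "V - {i}" j])
    have eq: "(\<Sum>v\<in>V - {i} - {j}. h (f' v)) = (\<Sum>v\<in>V - {i} - {j}. h (f v))" for h :: "nat \<Rightarrow> nat"
      by (intro sum.cong) (auto simp: f'_def)
    have "(\<Sum>v\<in>V. f' v) = (\<Sum>v\<in>V. f v)"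
      unfolding rm[of f'] rm[of f] eq[of "\<lambda>x. x"] using ij ne by (simp add: f'_def)
    moreover have "(\<Sum>v\<in>V. f' v - d) < (\<Sum>v\<in>V. f v - d)"
      unfolding rm[of "\<lambda>v. f' v - d"] rm[of "\<lambda>v. f v - d"] eq[of "\<lambda>x. x - d"] using ij ne by (simp add: f'_def)
    ultimately have "card (degree_class V f') \<le> card (degree_class V (\<lambda>_. d))"
      using less by auto
    moreover have "card (degree_class V f) \<le> card (degree_class V f')"
      unfolding f'_def using ij by (intro card_degree_class_balance V) auto
    ultimately show ?thesis by simp
  qed
qed

text \<open>All sequences counted here have the same geometric weight \<open>z ^ (n * d)\<close>, so
  the weighted count bounds their number.\<close>

lemma card_sequences_le:
  assumes V: "finite V" and "d > 0"
  shows "real (card {f \<in> V \<rightarrow>\<^sub>E {..card V * d}. (\<Sum>v\<in>V. f v) = card V * d}) \<le> (exp 1 * (real d + 1)) ^ card V"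
    (is "real (card ?S) \<le> _")
proof -
  define n where "n = card V"
  \<comment> \<open>The geometric distribution with parameter \<open>z\<close> has mean
    \<open>d\<close>. Per vertex, the generating function costs \<open>1 / (1 - z) = d + 1\<close>
    and the normalisation \<open>(1 / z) ^ d \<le> exp 1\<close>.\<close>
  define z :: real where "z = real d / (real d + 1)"
  have z: "0 < z" "z < 1" using assms by (auto simp: z_def)
  have "real (card ?S) * z ^ (n * d) \<le> (\<Sum>j\<in>{..n * d}. z ^ j) ^ card V"
  proof (rule card_PiE_le_weight[OF V])
    show "z ^ (n * d) \<le> (\<Prod>i\<in>V. z ^ x i)" if "x \<in> ?S" for x
      using that by (simp add: power_sum[symmetric] n_def)
  qed (use z in \<open>auto simp: n_def\<close>)
  also have "\<dots> \<le> (real d + 1) ^ card V"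
  proof (intro power_mono sum_nonneg)
    have "(\<Sum>j\<in>{..n * d}. z ^ j) \<le> 1 / (1 - z)"
      using z by (simp add: sum_gp0 field_simps)
    also have "1 / (1 - z) = real d + 1" by (simp add: z_def field_simps)
    finally show "(\<Sum>j\<in>{..n * d}. z ^ j) \<le> real d + 1" .
  qed (use z in auto)
  finally have 1: "real (card ?S) * z ^ (n * d) \<le> (real d + 1) ^ n"
    by (simp add: n_def)
  have "(1 / z) ^ d \<le> exp 1"
  proof -
    have "1 / z = 1 + 1 / real d" using assms by (simp add: z_def field_simps)
    also have "\<dots> \<le> exp (1 / real d)" by (rule exp_ge_add_one_self)
    finally have "(1 / z) ^ d \<le> exp (1 / real d) ^ d" using z by (intro power_mono) auto
    also have "\<dots> = exp 1" using assms by (simp add: exp_of_nat_mult[symmetric])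
    finally show ?thesis .
  qed
  then have "((1 / z) ^ d) ^ n \<le> exp 1 ^ n" using z by (intro power_mono) auto
  moreover have "((1 / z) ^ d) ^ n = 1 / z ^ (n * d)"
    by (simp add: power_mult[symmetric] power_one_over mult.commute)
  ultimately have 2: "1 \<le> exp 1 ^ n * z ^ (n * d)"
    using z by (simp add: divide_le_eq)
  have "real (card ?S) \<le> real (card ?S) * (exp 1 ^ n * z ^ (n * d))"
    using mult_left_mono[OF 2, of "real (card ?S)"] by simp
  also have "\<dots> \<le> exp 1 ^ n * (real d + 1) ^ n"
    using mult_left_mono[OF 1, of "exp 1 ^ n"] by (simp add: mult_ac)
  finally show ?thesis by (simp add: n_def power_mult_distrib)
qed

text \<open>The graphs with \<open>m\<close> edges are covered by the classes of their degree
  sequences, none of which is larger than the regular class.\<close>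

lemma card_regular_ge:
  assumes V: "finite V" and d: "d > 0" and m: "card V * d = 2 * m"
  shows "real ((card V choose 2) choose m) \<le> (exp 1 * (real d + 1)) ^ card V * real (card (degree_class V (\<lambda>_. d)))"
proof -
  define S where "S = {f \<in> V \<rightarrow>\<^sub>E {..card V * d}. (\<Sum>v\<in>V. f v) = card V * d}"
  define G where "G = {E. E \<subseteq> pairs V \<and> card E = m}"
  have "G \<subseteq> (\<Union>f\<in>S. degree_class V f)"
  proof
    fix E assume "E \<in> G"
    then have E: "E \<subseteq> pairs V" "card E = m" by (auto simp: G_def)
    have s: "(\<Sum>v\<in>V. deg E v) = card V * d" using sum_deg[OF V E(1)] E(2) m by simp
    have "deg E v \<le> card V * d" if "v \<in> V" for v
      using member_le_sum[of v V "deg E"] that V s by auto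
    then have "restrict (deg E) V \<in> S" using s by (auto simp: S_def)
    moreover have "E \<in> degree_class V (restrict (deg E) V)" using E by (auto simp: degree_class_def)
    ultimately show "E \<in> (\<Union>f\<in>S. degree_class V f)" by blast
  qed
  moreover have fS: "finite S" unfolding S_def by (rule finite_subset[of _ "V \<rightarrow>\<^sub>E {..card V * d}"]) (auto intro: finite_PiE V)
  ultimately have "card G \<le> card (\<Union>f\<in>S. degree_class V f)"
    using V by (intro card_mono finite_UN_I) (auto simp: finite_degree_class)
  also have "\<dots> \<le> (\<Sum>f\<in>S. card (degree_class V f))" by (rule card_UN_le[OF fS])
  also have "\<dots> \<le> (\<Sum>f\<in>S. card (degree_class V (\<lambda>_. d)))"
    by (intro sum_mono card_degree_class_le_regular V) (auto simp: S_def)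
  finally have "card G \<le> card S * card (degree_class V (\<lambda>_. d))" by simp
  then have "real (card G) \<le> real (card S) * real (card (degree_class V (\<lambda>_. d)))"
    by (metis of_nat_le_iff of_nat_mult)
  also have "\<dots> \<le> (exp 1 * (real d + 1)) ^ card V * real (card (degree_class V (\<lambda>_. d)))"
    using card_sequences_le[OF V d] by (intro mult_right_mono) (auto simp: S_def)
  finally show ?thesis using n_subsets[OF finite_pairs[OF V]] card_pairs[OF V] by (simp add: G_def)
qed

section \<open>Traces of subgroups on finite sets of integer vectors\<close>

text \<open>A subset of size at most \<open>l\<close> is listed by a sequence of length
  \<open>l\<close>, padded with \<open>None\<close>.\<close>

lemma card_small_subsets_le:
  assumes "finite Q"
  shows "card {X. X \<subseteq> Q \<and> card X \<le> l} \<le> (card Q + 1) ^ l"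
proof -
  define F where "F = {..<l} \<rightarrow>\<^sub>E insert None (Some ` Q)"
  have "{X. X \<subseteq> Q \<and> card X \<le> l} \<subseteq> (\<lambda>g. {q. Some q \<in> g ` {..<l}}) ` F"
  proof
    fix X assume "X \<in> {X. X \<subseteq> Q \<and> card X \<le> l}"
    then have X: "X \<subseteq> Q" "card X \<le> l" by auto
    then have "finite X" using assms finite_subset by blast
    then obtain h where h: "bij_betw h {0..<card X} X" using ex_bij_betw_nat_finite by blast
    define g where "g = (\<lambda>i\<in>{..<l}. if i < card X then Some (h i) else None)"
    have hX: "h i \<in> X" if "i < card X" for i using h that by (auto simp: bij_betw_def)
    have "g \<in> F" using X hX by (fastforce simp: F_def g_def)
    moreover have "{q. Some q \<in> g ` {..<l}} = X"
    proof
      show "{q. Some q \<in> g ` {..<l}} \<subseteq> X" using hX by (auto simp: g_def split: if_splits)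
      show "X \<subseteq> {q. Some q \<in> g ` {..<l}}"
      proof
        fix q assume "q \<in> X"
        then have "q \<in> h ` {0..<card X}" using h by (simp add: bij_betw_def)
        then obtain i where i: "i < card X" "q = h i" by auto
        then have "g i = Some q" "i < l" using X by (auto simp: g_def)
        then show "q \<in> {q. Some q \<in> g ` {..<l}}" by (metis imageI lessThan_iff mem_Collect_eq)
      qed
    qed
    ultimately show "X \<in> (\<lambda>g. {q. Some q \<in> g ` {..<l}}) ` F" by blast
  qed
  moreover have "finite F" unfolding F_def using assms by (intro finite_PiE) auto
  ultimately have "card {X. X \<subseteq> Q \<and> card X \<le> l} \<le> card F" by (rule surj_card_le[rotated])
  also have "card F = (card Q + 1) ^ l"
    using assms by (simp add: F_def card_PiE card_image card_insert_if image_iff)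
  finally show ?thesis .
qed

section \<open>Dissociated sets and the traces they determine\<close>

definition dissociated :: "('i \<Rightarrow> int) set \<Rightarrow> bool" where
  "dissociated X \<longleftrightarrow> inj_on (\<lambda>A. \<Sum>A) (Pow X)"

text \<open>For finite \<open>X\<close> these are the combinations of \<open>X\<close> with
  coefficients in {-1, 0, 1}. Being dissociated then means that only the trivial combination of this
  kind vanishes.\<close>

definition subsum_differences :: "('i \<Rightarrow> int) set \<Rightarrow> ('i \<Rightarrow> int) set" where
  "subsum_differences X = {\<Sum>A - \<Sum>B | A B. A \<subseteq> X \<and> B \<subseteq> X}"

definition additive_subgroup :: "('i \<Rightarrow> int) set \<Rightarrow> bool" where
  "additive_subgroup P \<longleftrightarrow> 0 \<in> P \<and> (\<forall>x\<in>P. \<forall>y\<in>P. x + y \<in> P \<and> x - y \<in> P)"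

lemma additive_subgroup_sum:
  assumes "additive_subgroup P" "finite A" "A \<subseteq> P"
  shows "\<Sum>A \<in> P"
  using assms(2,3,1) by (induction A) (auto simp: additive_subgroup_def)

text \<open>In a coincidence of two different subset sums, \<open>q\<close> occurs on exactly one
  side, since otherwise it could be cancelled and \<open>X\<close> would not be dissociated. The
  equation is then solved for \<open>q\<close>.\<close>

lemma subsum_differences_insert:
  assumes "finite X" "dissociated X" "\<not> dissociated (insert q X)" "q \<notin> X"
  shows "q \<in> subsum_differences X"
proof -
  obtain A B where AB: "A \<subseteq> insert q X" "B \<subseteq> insert q X" "A \<noteq> B" "\<Sum>A = \<Sum>B"
    using assms(3) by (auto simp: dissociated_def inj_on_def)
  have sub: "A - {q} \<subseteq> X" "B - {q} \<subseteq> X" using AB by auto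
  have fin: "finite A" "finite B" using AB assms(1) finite_subset finite_insert by metis+
  have inj: "\<And>A B. A \<subseteq> X \<Longrightarrow> B \<subseteq> X \<Longrightarrow> \<Sum>A = \<Sum>B \<Longrightarrow> A = B"
    using assms(2) by (auto simp: dissociated_def inj_on_def)
  have rm: "\<Sum>A = q + \<Sum>(A - {q})" if "finite A" "q \<in> A" for A
    using sum.remove[OF that, of "\<lambda>x. x"] by simp
  consider "q \<in> A" "q \<in> B" | "q \<in> A" "q \<notin> B" | "q \<notin> A" "q \<in> B" | "q \<notin> A" "q \<notin> B" by blast
  then show ?thesis
  proof cases
    case 1
    then have "A - {q} = B - {q}"
      using rm[OF fin(1)] rm[OF fin(2)] AB(4) by (intro inj sub) (metis add_left_cancel)
    then show ?thesis using 1 AB(3) by blast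
  next
    case 2
    then have "B - {q} = B" by blast
    then have "q + \<Sum>(A - {q}) = \<Sum>(B - {q})" using rm[OF fin(1)] 2 AB(4) by metis
    then have "q = \<Sum>(B - {q}) - \<Sum>(A - {q})" by (metis add_diff_cancel_right')
    then show ?thesis using sub unfolding subsum_differences_def by blast
  next
    case 3
    then have "A - {q} = A" by blast
    then have "q + \<Sum>(B - {q}) = \<Sum>(A - {q})" using rm[OF fin(2)] 3 AB(4) by metis
    then have "q = \<Sum>(A - {q}) - \<Sum>(B - {q})" by (metis add_diff_cancel_right')
    then show ?thesis using sub unfolding subsum_differences_def by blast
  next
    case 4
    then have "A = B" using AB by (intro inj) auto
    then show ?thesis using AB(3) by blast
  qed
qed

text \<open>A maximal dissociated \<open>X\<close> inside \<open>Q \<inter> P\<close> works: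
  maximality expresses all of \<open>Q \<inter> P\<close> through \<open>X\<close>, and the subgroup
  \<open>P\<close> contains everything so expressed. The trace is therefore recovered from
  \<open>X\<close> without knowing \<open>P\<close>.\<close>

lemma subgroup_trace:
  assumes Q: "finite Q" and P: "additive_subgroup P"
  shows "\<exists>X\<subseteq>Q. dissociated X \<and> Q \<inter> P = Q \<inter> subsum_differences X"
proof -
  define D where "D = {X. X \<subseteq> Q \<inter> P \<and> dissociated X}"
  have "finite D" by (rule finite_subset[of _ "Pow Q"]) (auto simp: D_def Q)
  moreover have "{} \<in> D" by (simp add: D_def dissociated_def)
  ultimately obtain X where X: "X \<in> D" "\<And>Y. Y \<in> D \<Longrightarrow> X \<subseteq> Y \<Longrightarrow> X = Y"
    using finite_has_maximal[of D] by blast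
  have fX: "finite X" "X \<subseteq> Q \<inter> P" "dissociated X" using X Q finite_subset by (auto simp: D_def)
  have "Q \<inter> P \<subseteq> subsum_differences X"
  proof
    fix q assume q: "q \<in> Q \<inter> P"
    show "q \<in> subsum_differences X"
    proof (cases "q \<in> X")
      case True
      then have "{q} \<subseteq> X" "q = \<Sum>{q} - \<Sum>{}" by auto
      then show ?thesis unfolding subsum_differences_def by blast
    next
      case False
      then have "\<not> dissociated (insert q X)" using X(2)[of "insert q X"] q fX by (auto simp: D_def)
      then show ?thesis using subsum_differences_insert fX False by blast
    qed
  qed
  moreover have "subsum_differences X \<subseteq> P"
  proof
    fix y assume "y \<in> subsum_differences X"
    then obtain A B where "y = \<Sum>A - \<Sum>B" "A \<subseteq> X" "B \<subseteq> X" by (auto simp: subsum_differences_def)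
    moreover have "\<Sum>A \<in> P" "\<Sum>B \<in> P"
      using \<open>A \<subseteq> X\<close> \<open>B \<subseteq> X\<close> fX finite_subset by (auto intro!: additive_subgroup_sum P)
    ultimately show "y \<in> P" using P by (simp add: additive_subgroup_def)
  qed
  ultimately show ?thesis using fX by blast
qed

lemma sum_apply: "(\<Sum>x\<in>A. f x) i = (\<Sum>x\<in>A. f x i)" for f :: "'b \<Rightarrow> 'i \<Rightarrow> int"
  by (induction A rule: infinite_finite_induct) auto

lemma sum_geometric_abs_le:
  fixes z :: real
  assumes "0 < z" "z < 1"
  shows "(\<Sum>j\<in>{- int L..int L}. z ^ nat \<bar>j\<bar>) \<le> 2 / (1 - z)"
proof -
  have "{- int L..int L} \<subseteq> int ` {..L} \<union> (\<lambda>j. - int j) ` {..L}"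
  proof
    fix j assume "j \<in> {- int L..int L}"
    then show "j \<in> int ` {..L} \<union> (\<lambda>j. - int j) ` {..L}"
      by (cases j rule: int_cases2) auto
  qed
  then have "(\<Sum>j\<in>{- int L..int L}. z ^ nat \<bar>j\<bar>) \<le> (\<Sum>j\<in>int ` {..L} \<union> (\<lambda>j. - int j) ` {..L}. z ^ nat \<bar>j\<bar>)"
    using assms by (intro sum_mono2) auto
  also have "\<dots> \<le> (\<Sum>j\<in>int ` {..L}. z ^ nat \<bar>j\<bar>) + (\<Sum>j\<in>(\<lambda>j. - int j) ` {..L}. z ^ nat \<bar>j\<bar>)"
    using assms by (subst sum_Un) (auto intro: sum_nonneg)
  also have "\<dots> = (\<Sum>j\<le>L. z ^ j) + (\<Sum>j\<le>L. z ^ j)"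
    by (subst (1 2) sum.reindex) (auto simp: inj_on_def)
  also have "(\<Sum>j\<le>L. z ^ j) \<le> 1 / (1 - z)"
    using assms by (simp add: sum_gp0 field_simps)
  finally show ?thesis by simp
qed

text \<open>The \<open>2 ^ l\<close> distinct subset sums are integer points of norm at most
  \<open>l * B\<close>. Weighting points by \<open>z\<close> to the power of their norm bounds the
  number of such points.\<close>

lemma card_dissociated_le:
  fixes X :: "('i \<Rightarrow> int) set"
  assumes I: "finite I" and X: "finite X" "dissociated X" and B: "B \<ge> 1"
    and supp: "\<And>x i. x \<in> X \<Longrightarrow> i \<notin> I \<Longrightarrow> x i = 0"
    and norm: "\<And>x. x \<in> X \<Longrightarrow> (\<Sum>i\<in>I. \<bar>x i\<bar>) \<le> int B"
  shows "real (card X) \<le> 3 * real (card I) * ln (8 * real B + 2)"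
proof -
  define l where "l = card X"
  \<comment> \<open>With this choice the weight \<open>z ^ (l * B)\<close> is
    \<open>exp (- l / 4)\<close>, which loses less than the factor \<open>2 ^ l\<close>
    gains.\<close>
  define z :: real where "z = exp (- 1 / (4 * real B))"
  have z: "0 < z" "z < 1" using B by (auto simp: z_def)
  \<comment> \<open>The restriction to \<open>I\<close> places the sums in a space of extensional
    functions; by \<open>supp\<close> it forgets nothing.\<close>
  define s where "s = (\<lambda>A :: ('i \<Rightarrow> int) set. restrict (\<Sum>A) I)"
  have norm_s: "(\<Sum>i\<in>I. \<bar>(\<Sum>A) i\<bar>) \<le> int (l * B)" if "A \<subseteq> X" for A
  proof -
    have "(\<Sum>i\<in>I. \<bar>(\<Sum>A) i\<bar>) \<le> (\<Sum>i\<in>I. \<Sum>x\<in>A. \<bar>x i\<bar>)"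
      unfolding sum_apply by (intro sum_mono sum_abs)
    also have "\<dots> = (\<Sum>x\<in>A. \<Sum>i\<in>I. \<bar>x i\<bar>)" by (rule sum.swap)
    also have "\<dots> \<le> (\<Sum>x\<in>A. int B)" using that norm by (intro sum_mono) auto
    also have "\<dots> \<le> int (l * B)" using card_mono[OF X(1) that] by (simp add: l_def mult_right_mono)
    finally show ?thesis .
  qed
  have "inj_on s (Pow X)"
  proof (rule inj_onI)
    fix A C assume AC: "A \<in> Pow X" "C \<in> Pow X" "s A = s C"
    have "(\<Sum>A) i = (\<Sum>C) i" for i
    proof (cases "i \<in> I")
      case True
      then show ?thesis using fun_cong[OF AC(3), of i] by (simp add: s_def)
    next
      case False
      then have "(\<Sum>A) i = 0" if "A \<subseteq> X" for A
        using that supp unfolding sum_apply by (intro sum.neutral) auto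
      then show ?thesis using AC by simp
    qed
    then have "\<Sum>A = \<Sum>C" by (rule ext)
    then show "A = C" using X(2) AC by (auto simp: dissociated_def inj_on_def)
  qed
  then have "card (s ` Pow X) = 2 ^ l" using X(1) by (simp add: card_image card_Pow l_def)
  moreover have "real (card (s ` Pow X)) * z ^ (l * B) \<le> (\<Sum>j\<in>{- int (l * B)..int (l * B)}. z ^ nat \<bar>j\<bar>) ^ card I"
  proof (rule card_PiE_le_weight[OF I])
    show "s ` Pow X \<subseteq> I \<rightarrow>\<^sub>E {- int (l * B)..int (l * B)}"
    proof
      fix y assume "y \<in> s ` Pow X"
      then obtain A where A: "A \<subseteq> X" "y = s A" by auto
      have "\<bar>(\<Sum>A) i\<bar> \<le> int (l * B)" if "i \<in> I" for i
        using norm_s[OF A(1)] member_le_sum[of i I "\<lambda>i. \<bar>(\<Sum>A) i\<bar>"] I that by simp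
      then show "y \<in> I \<rightarrow>\<^sub>E {- int (l * B)..int (l * B)}" using A by (force simp: s_def)
    qed
    fix y assume "y \<in> s ` Pow X"
    then obtain A where A: "A \<subseteq> X" "y = s A" by auto
    have "(\<Prod>i\<in>I. z ^ nat \<bar>y i\<bar>) = z ^ (\<Sum>i\<in>I. nat \<bar>(\<Sum>A) i\<bar>)"
      unfolding A(2) s_def by (simp add: power_sum)
    moreover have "(\<Sum>i\<in>I. nat \<bar>(\<Sum>A) i\<bar>) \<le> l * B"
    proof -
      have "int (\<Sum>i\<in>I. nat \<bar>(\<Sum>A) i\<bar>) \<le> int (l * B)" using norm_s[OF A(1)] by simp
      then show ?thesis by linarith
    qed
    ultimately show "z ^ (l * B) \<le> (\<Prod>i\<in>I. z ^ nat \<bar>y i\<bar>)" using z by (simp add: power_decreasing)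
  qed (use z in auto)
  moreover have "(\<Sum>j\<in>{- int (l * B)..int (l * B)}. z ^ nat \<bar>j\<bar>) ^ card I \<le> (8 * real B + 2) ^ card I"
  proof (intro power_mono sum_nonneg)
    define a where "a = 1 / (4 * real B)"
    have a: "a > 0" using B by (simp add: a_def)
    have "z = 1 / exp a" by (simp add: z_def a_def exp_minus field_simps)
    also have "\<dots> \<le> 1 / (1 + a)" using a exp_ge_add_one_self[of a] by (intro divide_left_mono) auto
    finally have "1 - z \<ge> a / (1 + a)" using a by (simp add: field_simps)
    then have "2 / (1 - z) \<le> 2 / (a / (1 + a))" using a z by (intro divide_left_mono) auto
    also have "\<dots> = 8 * real B + 2" using B by (simp add: a_def field_simps)
    finally show "(\<Sum>j\<in>{- int (l * B)..int (l * B)}. z ^ nat \<bar>j\<bar>) \<le> 8 * real B + 2"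
      using sum_geometric_abs_le[OF z, of "l * B"] by simp
  qed (use z in auto)
  ultimately have main: "2 ^ l * z ^ (l * B) \<le> (8 * real B + 2) ^ card I" by simp
  have "ln (2 ^ l * z ^ (l * B)) = real l * ln 2 - real l / 4"
    using z B by (simp add: ln_mult ln_realpow z_def)
  moreover have "ln (2 ^ l * z ^ (l * B)) \<le> ln ((8 * real B + 2) ^ card I)"
    using main z by (subst ln_le_cancel_iff) auto
  ultimately have "real l * ln 2 - real l / 4 \<le> real (card I) * ln (8 * real B + 2)"
    by (simp add: ln_realpow)
  \<comment> \<open>The constant 3 in the claim is admissible because 2/3 - 1/4 = 5/12 exceeds
    1/3.\<close>
  moreover have "real l * (2/3) \<le> real l * ln 2" using ln2_ge_two_thirds by (intro mult_left_mono) auto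
  ultimately show ?thesis by (simp add: l_def)
qed

lemma card_subgroup_traces_le:
  fixes Q :: "('i \<Rightarrow> int) set"
  assumes I: "finite I" and Q: "finite Q" and B: "B \<ge> 1"
    and supp: "\<And>x i. x \<in> Q \<Longrightarrow> i \<notin> I \<Longrightarrow> x i = 0"
    and norm: "\<And>x. x \<in> Q \<Longrightarrow> (\<Sum>i\<in>I. \<bar>x i\<bar>) \<le> int B"
    and l: "3 * real (card I) * ln (8 * real B + 2) \<le> real l"
  shows "card {Q \<inter> P | P. additive_subgroup P} \<le> (card Q + 1) ^ l"
proof -
  have "{Q \<inter> P | P. additive_subgroup P} \<subseteq> (\<lambda>X. Q \<inter> subsum_differences X) ` {X. X \<subseteq> Q \<and> card X \<le> l}"
  proof
    fix Y assume "Y \<in> {Q \<inter> P | P. additive_subgroup P}"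
    then obtain P where "additive_subgroup P" "Y = Q \<inter> P" by blast
    then obtain X where X: "X \<subseteq> Q" "dissociated X" "Y = Q \<inter> subsum_differences X"
      using subgroup_trace[OF Q] by metis
    have "real (card X) \<le> 3 * real (card I) * ln (8 * real B + 2)"
      using X supp norm by (intro card_dissociated_le I B) (auto intro: finite_subset Q)
    then have "card X \<le> l" using l by linarith
    then show "Y \<in> (\<lambda>X. Q \<inter> subsum_differences X) ` {X. X \<subseteq> Q \<and> card X \<le> l}" using X by blast
  qed
  moreover have "finite {X. X \<subseteq> Q \<and> card X \<le> l}" using Q by simp
  ultimately have "card {Q \<inter> P | P. additive_subgroup P} \<le> card {X. X \<subseteq> Q \<and> card X \<le> l}"
    by (rule surj_card_le[rotated])
  then show ?thesis using card_small_subsets_le[OF Q, of l] by linarith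
qed

section \<open>Shallow spanning forests\<close>

text \<open>Reflexive, so that the \<open>i\<close>-th power of the relation reaches all vertices at
  distance at most \<open>i\<close> and the balls increase with the radius.\<close>

definition adj :: "'a set set \<Rightarrow> ('a \<times> 'a) set" where
  "adj E = {(v, w). v = w \<or> {v, w} \<in> E}"

definition gball :: "'a set set \<Rightarrow> nat \<Rightarrow> 'a \<Rightarrow> 'a set" where
  "gball E i r = (adj E ^^ i) `` {r}"

text \<open>The counter bounds the number of steps to the parent. It only has to be at least the
  depth of \<open>v\<close> for the result to be the root of the tree of \<open>v\<close>.\<close>

fun tree_root :: "'a set \<Rightarrow> ('a \<Rightarrow> 'a) \<Rightarrow> nat \<Rightarrow> 'a \<Rightarrow> 'a" where
  "tree_root R par 0 v = v"
| "tree_root R par (Suc i) v = (if v \<in> R then v else tree_root R par i (par v))"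

lemma gball_0 [simp]: "gball E 0 r = {r}"
  by (simp add: gball_def)

lemma gball_Suc: "gball E (Suc i) r = adj E `` gball E i r"
  by (auto simp: gball_def)

lemma gball_mono: "i \<le> j \<Longrightarrow> gball E i r \<subseteq> gball E j r"
  by (rule lift_Suc_mono_le) (auto simp: gball_Suc adj_def)

lemma gball_subset:
  assumes "E \<subseteq> pairs V" "r \<in> V"
  shows "gball E i r \<subseteq> V"
  using assms by (induction i) (auto simp: gball_Suc adj_def pairs_def)

lemma adj_sym: "(v, w) \<in> adj E \<Longrightarrow> (w, v) \<in> adj E"
  by (auto simp: adj_def insert_commute)

lemma adj_relpow_sym: "(v, w) \<in> adj E ^^ i \<Longrightarrow> (w, v) \<in> adj E ^^ i"
proof (induction i arbitrary: w)
  case (Suc i)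
  then obtain x where "(v, x) \<in> adj E ^^ i" "(x, w) \<in> adj E" by auto
  then show ?case using Suc.IH adj_sym relpow_Suc_I2 by metis
qed simp

lemma gball_meet:
  assumes "x \<in> gball E i v" "x \<in> gball E j r"
  shows "v \<in> gball E (j + i) r"
  using assms adj_relpow_sym[of v x i E] by (auto simp: gball_def relpow_add)

text \<open>A ball that stops growing never grows again, and until then each step adds at least one
  vertex.\<close>

lemma gball_closed_or_large:
  assumes "finite V" "E \<subseteq> pairs V" "r \<in> V"
  shows "gball E (Suc i) r = gball E i r \<or> card (gball E i r) \<ge> Suc i"
proof (induction i)
  case (Suc i)
  show ?case
  proof (cases "gball E (Suc i) r = gball E i r")
    case True
    then have "gball E (Suc (Suc i)) r = gball E (Suc i) r" by (simp add: gball_Suc[of E "Suc i"] gball_Suc[of E i])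
    then show ?thesis by simp
  next
    case False
    then have "gball E i r \<subset> gball E (Suc i) r" using gball_mono[of i "Suc i" E r] by auto
    moreover have "finite (gball E (Suc i) r)" using gball_subset assms finite_subset by metis
    ultimately have "card (gball E i r) < card (gball E (Suc i) r)" by (rule psubset_card_mono[rotated])
    then show ?thesis using Suc False by simp
  qed
qed simp

text \<open>Every step to the parent runs along an edge, so it can neither leave nor enter a set
  closed under adjacency.\<close>

lemma tree_root_closed_iff:
  assumes "\<And>v. v \<in> V - R \<Longrightarrow> par v \<in> V \<and> {v, par v} \<in> E"
    and "\<And>u v. {u, v} \<in> E \<Longrightarrow> u \<in> Y \<Longrightarrow> v \<in> Y" and "v \<in> V"
  shows "tree_root R par i v \<in> Y \<longleftrightarrow> v \<in> Y"
  using assms(3)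
proof (induction i arbitrary: v)
  case (Suc i)
  show ?case
  proof (cases "v \<in> R")
    case False
    then have "par v \<in> V" "{v, par v} \<in> E" using assms(1) Suc.prems by auto
    then have "par v \<in> Y \<longleftrightarrow> v \<in> Y" using assms(2) by (metis insert_commute)
    then show ?thesis using False Suc.IH \<open>par v \<in> V\<close> by simp
  qed simp
qed simp

text \<open>The roots form a maximal set with pairwise disjoint balls of radius \<open>s\<close>. A ball with at most
  \<open>s\<close> vertices is a whole component.\<close>

lemma shallow_spanning_forest:
  assumes V: "finite V" and E: "E \<subseteq> pairs V"
  obtains R D :: "'a set" and par :: "'a \<Rightarrow> 'a" and dep :: "'a \<Rightarrow> nat" where
    "R \<subseteq> V" "D \<subseteq> R"
    "\<And>v. v \<in> R \<Longrightarrow> dep v = 0"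
    "par \<in> V - R \<rightarrow>\<^sub>E V"
    "\<And>v. v \<in> V - R \<Longrightarrow> {v, par v} \<in> E \<and> dep v = Suc (dep (par v))"
    "\<And>v. v \<in> V \<Longrightarrow> dep v \<le> 2 * s"
    "\<And>v. v \<in> V \<Longrightarrow> tree_root R par (2 * s) v \<in> R"
    "card (R - D) * (s + 1) \<le> card V"
    "\<And>u v. {u, v} \<in> E \<Longrightarrow> tree_root R par (2 * s) u \<in> D \<Longrightarrow> tree_root R par (2 * s) v = tree_root R par (2 * s) u"
    "\<And>r. r \<in> D \<Longrightarrow> card {v \<in> V. tree_root R par (2 * s) v = r} \<le> s"
proof -
  define F where "F = {R. R \<subseteq> V \<and> (\<forall>r\<in>R. \<forall>r'\<in>R. r \<noteq> r' \<longrightarrow> gball E s r \<inter> gball E s r' = {})}"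
  have "finite F" by (rule finite_subset[of _ "Pow V"]) (auto simp: F_def V)
  moreover have "{} \<in> F" by (simp add: F_def)
  ultimately obtain R where R: "R \<in> F" "\<And>Y. Y \<in> F \<Longrightarrow> R \<subseteq> Y \<Longrightarrow> R = Y"
    using finite_has_maximal[of F] by blast
  have RV: "R \<subseteq> V" and disj: "\<And>r r'. r \<in> R \<Longrightarrow> r' \<in> R \<Longrightarrow> r \<noteq> r' \<Longrightarrow> gball E s r \<inter> gball E s r' = {}"
    using R(1) by (auto simp: F_def)
  have self: "v \<in> gball E i v" for v i using gball_mono[of 0 i E v] by auto
  \<comment> \<open>By maximality of \<open>R\<close> the ball around \<open>v\<close> meets the
    ball around some root, so the two centres are at distance at most \<open>2 * s\<close>.\<close>
  have cover: "\<exists>r\<in>R. v \<in> gball E (2 * s) r" if vV: "v \<in> V" for v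
  proof (cases "v \<in> R")
    case True
    then show ?thesis using self by blast
  next
    case False
    then have "insert v R \<notin> F" using R(2)[of "insert v R"] by auto
    then obtain r where r: "r \<in> R" "gball E s v \<inter> gball E s r \<noteq> {}"
      using R(1) vV unfolding F_def by (smt (verit) Int_commute insert_iff insert_subset mem_Collect_eq)
    then show ?thesis using gball_meet[of _ E s v s r] by (auto simp: mult_2)
  qed
  \<comment> \<open>The distance to the nearest root; parents will be neighbours that are nearer by
    one.\<close>
  define dep where "dep = (\<lambda>v. LEAST i. \<exists>r\<in>R. v \<in> gball E i r)"
  have dep_ball: "\<exists>r\<in>R. v \<in> gball E (dep v) r" if "v \<in> V" for v
    unfolding dep_def using LeastI[of "\<lambda>i. \<exists>r\<in>R. v \<in> gball E i r", OF cover[OF that]] .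
  have dep_le: "dep v \<le> i" if "r \<in> R" "v \<in> gball E i r" for v i r
    unfolding dep_def by (rule Least_le) (use that in blast)
  have ex_par: "\<exists>w. w \<in> V \<and> {v, w} \<in> E \<and> dep v = Suc (dep w)" if vV: "v \<in> V - R" for v
  proof -
    obtain r where r: "r \<in> R" "v \<in> gball E (dep v) r" using dep_ball vV by blast
    then have "dep v \<noteq> 0" using vV by (cases "dep v") auto
    then obtain i where i: "dep v = Suc i" using not0_implies_Suc by blast
    then obtain w where w: "w \<in> gball E i r" "(w, v) \<in> adj E" using r by (auto simp: gball_Suc)
    have wi: "dep w \<le> i" by (rule dep_le[OF r(1) w(1)])
    have wV: "w \<in> V" using gball_subset[OF E] r RV w by blast
    obtain r' where r': "r' \<in> R" "w \<in> gball E (dep w) r'" using dep_ball[OF wV] by blast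
    have "v \<in> gball E (Suc (dep w)) r'" using r'(2) w(2) by (auto simp: gball_Suc)
    then have "dep v \<le> Suc (dep w)" by (rule dep_le[OF r'(1)])
    then have "dep v = Suc (dep w)" using wi i by simp
    then show ?thesis using w wV by (auto simp: adj_def insert_commute)
  qed
  define par where "par = (\<lambda>v\<in>V - R. SOME w. w \<in> V \<and> {v, w} \<in> E \<and> dep v = Suc (dep w))"
  have par: "par v \<in> V \<and> {v, par v} \<in> E \<and> dep v = Suc (dep (par v))" if "v \<in> V - R" for v
    unfolding par_def restrict_apply'[OF that] by (rule someI_ex[OF ex_par[OF that]])
  have par_PiE: "par \<in> V - R \<rightarrow>\<^sub>E V" using par by (simp add: PiE_def Pi_def par_def)
  have dep0: "dep v = 0" if "v \<in> R" for v using dep_le[OF that self, of 0] by simp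
  have dep2: "dep v \<le> 2 * s" if "v \<in> V" for v using cover[OF that] dep_le by blast
  \<comment> \<open>Roots with small balls. Such a ball has stopped growing by radius
    \<open>s\<close>, so it is a union of nothing less than the whole component of its
    centre.\<close>
  define D where "D = {r \<in> R. card (gball E s r) \<le> s}"
  have DR: "D \<subseteq> R" by (auto simp: D_def)
  have root_in: "tree_root R par i v \<in> R" if "v \<in> V" "dep v \<le> i" for v i
    using that
  proof (induction i arbitrary: v)
    case 0
    then show ?case using par[of v] by auto
  next
    case (Suc i)
    then show ?case using par[of v] by auto
  qed
  have closed: "v \<in> gball E s r" if "r \<in> D" "{u, v} \<in> E" "u \<in> gball E s r" for r u v
  proof -
    have "gball E (Suc s) r = gball E s r"
      using gball_closed_or_large[OF V E, of r s] that(1) RV by (auto simp: D_def)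
    moreover have "v \<in> gball E (Suc s) r" using that by (auto simp: gball_Suc adj_def)
    ultimately show ?thesis by simp
  qed
  \<comment> \<open>A closed ball contains no root besides its centre, because the balls of
    different roots are disjoint. Hence its vertices are exactly those whose climb ends in
    \<open>r\<close>.\<close>
  have root_iff: "tree_root R par (2 * s) v = r \<longleftrightarrow> v \<in> gball E s r" if "r \<in> D" "v \<in> V" for r v
  proof -
    have "tree_root R par (2 * s) v \<in> gball E s r \<longleftrightarrow> v \<in> gball E s r"
      by (rule tree_root_closed_iff[of V R par E]) (use par closed[OF that(1)] that in auto)
    moreover have "tree_root R par (2 * s) v \<in> R" by (rule root_in[OF that(2) dep2[OF that(2)]])
    moreover have "x = r" if "x \<in> R" "x \<in> gball E s r" for x
      using disj[of x r] that self[of x s] \<open>r \<in> D\<close> DR by blast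
    ultimately show ?thesis using self[of r s] by blast
  qed
  \<comment> \<open>The remaining roots have disjoint balls of at least \<open>s + 1\<close>
    vertices each.\<close>
  have "card (R - D) * (s + 1) \<le> card V"
  proof -
    have fR: "finite R" using RV V finite_subset by blast
    have "card (R - D) * (s + 1) = (\<Sum>r\<in>R - D. s + 1)" by simp
    also have "\<dots> \<le> (\<Sum>r\<in>R - D. card (gball E s r))" by (intro sum_mono) (auto simp: D_def)
    also have "\<dots> = card (\<Union>r\<in>R - D. gball E s r)"
    proof (rule card_UN_disjoint[symmetric])
      show "\<forall>r\<in>R - D. finite (gball E s r)"
        using gball_subset[OF E] RV finite_subset[OF _ V] by blast
    qed (use fR disj in auto)
    also have "\<dots> \<le> card V" using gball_subset[OF E] RV by (intro card_mono V) blast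
    finally show ?thesis .
  qed
  moreover have "tree_root R par (2 * s) v = tree_root R par (2 * s) u"
    if "{u, v} \<in> E" "tree_root R par (2 * s) u \<in> D" for u v
  proof -
    have uv: "u \<in> V" "v \<in> V" using that(1) E by (auto simp: pairs_def)
    show ?thesis using root_iff[OF that(2)] uv closed[OF that(2,1)] by blast
  qed
  moreover have "card {v \<in> V. tree_root R par (2 * s) v = r} \<le> s" if "r \<in> D" for r
  proof -
    have "{v \<in> V. tree_root R par (2 * s) v = r} = gball E s r"
      using root_iff[OF that] gball_subset[OF E, of r s] that DR RV by blast
    then show ?thesis using that by (simp add: D_def)
  qed
  ultimately show ?thesis using that[of R D dep par] RV DR dep0 par par_PiE dep2 root_in by blast
qed

section \<open>Encoding graphs with few edge sums\<close>

definition ivec :: "'i \<Rightarrow> 'i \<Rightarrow> int" where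
  "ivec i = (\<lambda>j. if j = i then 1 else 0)"

text \<open>\<open>formal_label\<close> solves \<open>A v + A (par v) = s (col v)\<close> for the label of \<open>v\<close> in terms of the sums
  (coordinates \<open>Inl\<close>) and of the labels of the roots (coordinates \<open>Inr\<close>).\<close>

fun formal_label :: "'v set \<Rightarrow> ('v \<Rightarrow> 'v) \<Rightarrow> ('v \<Rightarrow> 'c) \<Rightarrow> nat \<Rightarrow> 'v \<Rightarrow> 'c + 'v \<Rightarrow> int" where
  "formal_label R par col 0 v = ivec (Inr v)"
| "formal_label R par col (Suc i) v =
     (if v \<in> R then ivec (Inr v) else ivec (Inl (col v)) - formal_label R par col i (par v))"

text \<open>Evaluated at the actual sums and labels it vanishes exactly if the labels of
  \<open>u\<close> and \<open>v\<close> add up to the sum with number \<open>c\<close>, provided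
  that \<open>i\<close> is at least the depths of \<open>u\<close> and \<open>v\<close>.\<close>

definition relation_vector :: "'v set \<Rightarrow> ('v \<Rightarrow> 'v) \<Rightarrow> ('v \<Rightarrow> nat) \<Rightarrow> nat \<Rightarrow> 'v \<Rightarrow> 'v \<Rightarrow> nat \<Rightarrow> nat + 'v \<Rightarrow> int" where
  "relation_vector R par col i u v c = formal_label R par col i u + formal_label R par col i v - ivec (Inl c)"

text \<open>Vertices in small components are left out, so that only the few roots in
  \<open>R - D\<close> appear as coordinates.\<close>

definition relation_vectors :: "'v set \<Rightarrow> nat \<Rightarrow> 'v set \<Rightarrow> 'v set \<Rightarrow> ('v \<Rightarrow> 'v) \<Rightarrow> ('v \<Rightarrow> nat) \<Rightarrow> nat \<Rightarrow> (nat + 'v \<Rightarrow> int) set" where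
  "relation_vectors V K R D par col i =
     {relation_vector R par col i u v c | u v c.
        u \<in> V \<and> v \<in> V \<and> c < K \<and> tree_root R par i u \<in> R - D \<and> tree_root R par i v \<in> R - D}"

text \<open>The supergraph of \<open>E\<close> that can be rebuilt from the code: cliques on the
  small components, and elsewhere the pairs for which \<open>X\<close> records some sum.\<close>

definition sum_graph :: "'v set \<Rightarrow> nat \<Rightarrow> 'v set \<Rightarrow> 'v set \<Rightarrow> ('v \<Rightarrow> 'v) \<Rightarrow> ('v \<Rightarrow> nat) \<Rightarrow> nat \<Rightarrow> (nat + 'v \<Rightarrow> int) set \<Rightarrow> 'v set set" where
  "sum_graph V K R D par col i X =
     {{u, v} | u v. u \<in> V \<and> v \<in> V \<and> u \<noteq> v \<and>
        (tree_root R par i u \<in> D \<and> tree_root R par i v = tree_root R par i u \<or>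
         tree_root R par i u \<in> R - D \<and> tree_root R par i v \<in> R - D \<and>
         (\<exists>c<K. relation_vector R par col i u v c \<in> X))}"

definition tree_edges :: "'v set \<Rightarrow> 'v set \<Rightarrow> ('v \<Rightarrow> 'v) \<Rightarrow> 'v set set" where
  "tree_edges V R par = (\<lambda>v. {v, par v}) ` (V - R)"

text \<open>The group survives only as the subgroup \<open>P\<close>, of which only the trace on the
  relation vectors matters. The tree edges are kept apart from \<open>sum_graph\<close> because the
  forest already specifies them, which leaves fewer edges to be chosen. The functions are
  extensional so that they can be counted.\<close>

definition encodable :: "'v set \<Rightarrow> nat \<Rightarrow> nat \<Rightarrow> 'v set set \<Rightarrow> bool" where
  "encodable V K s E \<longleftrightarrow>
     (\<exists>R D par col P. R \<subseteq> V \<and> D \<subseteq> R \<and> par \<in> V - R \<rightarrow>\<^sub>E V \<and> col \<in> V - R \<rightarrow>\<^sub>E {..<K} \<and>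
        card (R - D) * (s + 1) \<le> card V \<and> additive_subgroup P \<and>
        tree_edges V R par \<subseteq> E \<and> card (tree_edges V R par) = card (V - R) \<and>
        E - tree_edges V R par \<subseteq> sum_graph V K R D par col (2 * s) (relation_vectors V K R D par col (2 * s) \<inter> P) \<and>
        2 * card (sum_graph V K R D par col (2 * s) (relation_vectors V K R D par col (2 * s) \<inter> P)) \<le> card V * K)"

section \<open>Support, norm and number of the relation vectors\<close>

lemma formal_label_support:
  assumes par: "par \<in> V - R \<rightarrow> V" and col: "col \<in> V - R \<rightarrow> {..<K}" and "v \<in> V"
    and "j \<notin> Inl ` {..<K} \<union> {Inr (tree_root R par i v)}"
  shows "formal_label R par col i v j = 0"
  using assms(3,4)
proof (induction i arbitrary: v)
  case (Suc i)
  then show ?case using par col by (cases "v \<in> R") (auto simp: ivec_def Pi_def)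
qed (auto simp: ivec_def)

lemma sum_abs_ivec_le:
  assumes "finite I" shows "(\<Sum>j\<in>I. \<bar>ivec i j\<bar>) \<le> 1"
  using assms by (simp add: ivec_def if_distrib[of abs] sum.If_cases Int_def card_le_Suc0_iff_eq)

lemma sum_abs_diff_le:
  fixes x y :: "'i \<Rightarrow> int"
  assumes "(\<Sum>j\<in>I. \<bar>x j\<bar>) \<le> a" "(\<Sum>j\<in>I. \<bar>y j\<bar>) \<le> b"
  shows "(\<Sum>j\<in>I. \<bar>(x - y) j\<bar>) \<le> a + b" "(\<Sum>j\<in>I. \<bar>(x + y) j\<bar>) \<le> a + b"
proof -
  have "(\<Sum>j\<in>I. \<bar>(x - y) j\<bar>) \<le> (\<Sum>j\<in>I. \<bar>x j\<bar> + \<bar>y j\<bar>)" by (intro sum_mono) auto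
  then show "(\<Sum>j\<in>I. \<bar>(x - y) j\<bar>) \<le> a + b" using assms by (simp add: sum.distrib)
  have "(\<Sum>j\<in>I. \<bar>(x + y) j\<bar>) \<le> (\<Sum>j\<in>I. \<bar>x j\<bar> + \<bar>y j\<bar>)" by (intro sum_mono) auto
  then show "(\<Sum>j\<in>I. \<bar>(x + y) j\<bar>) \<le> a + b" using assms by (simp add: sum.distrib)
qed

lemma formal_label_norm:
  assumes "finite I"
  shows "(\<Sum>j\<in>I. \<bar>formal_label R par col i v j\<bar>) \<le> int i + 1"
proof (induction i arbitrary: v)
  case 0
  then show ?case using sum_abs_ivec_le[OF assms] by simp
next
  case (Suc i)
  then show ?case
    using sum_abs_ivec_le[OF assms, of "Inr v"]
      sum_abs_diff_le(1)[OF sum_abs_ivec_le[OF assms, of "Inl (col v)"] Suc, of "par v"]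
    by (cases "v \<in> R") auto
qed

lemma relation_vectors_eq_image:
  "relation_vectors V K R D par col i = (\<lambda>(u, v, c). relation_vector R par col i u v c) `
     {(u, v, c). u \<in> V \<and> v \<in> V \<and> c < K \<and> tree_root R par i u \<in> R - D \<and> tree_root R par i v \<in> R - D}"
  unfolding relation_vectors_def by (auto simp: image_iff) blast

lemma card_relation_vectors_le:
  assumes "finite V"
  shows "finite (relation_vectors V K R D par col i)"
    and "card (relation_vectors V K R D par col i) \<le> card V ^ 2 * K"
proof -
  have sub: "{(u, v, c). u \<in> V \<and> v \<in> V \<and> c < K \<and> tree_root R par i u \<in> R - D \<and> tree_root R par i v \<in> R - D}
      \<subseteq> V \<times> V \<times> {..<K}" (is "?S \<subseteq> _") by auto
  have fin: "finite (V \<times> V \<times> {..<K})" using assms by simp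
  show "finite (relation_vectors V K R D par col i)"
    unfolding relation_vectors_eq_image using finite_subset[OF sub fin] by (rule finite_imageI)
  have "card (relation_vectors V K R D par col i) \<le> card ?S"
    unfolding relation_vectors_eq_image using finite_subset[OF sub fin] by (rule card_image_le)
  also have "\<dots> \<le> card (V \<times> V \<times> {..<K})" by (rule card_mono[OF fin sub])
  also have "\<dots> = card V ^ 2 * K" by (simp add: power2_eq_square card_cartesian_product)
  finally show "card (relation_vectors V K R D par col i) \<le> card V ^ 2 * K" .
qed

text \<open>The relation vectors live on \<open>K\<close> sum coordinates and the roots in
  \<open>R - D\<close>, of which there are at most \<open>card V / (s + 1)\<close>. The bound on
  traces of subgroups then applies.\<close>

lemma card_relation_traces_le:
  fixes V :: "'v set"
  assumes V: "finite V" and R: "R \<subseteq> V"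
    and par: "par \<in> V - R \<rightarrow> V" and col: "col \<in> V - R \<rightarrow> {..<K}"
    and card: "card (R - D) * (s + 1) \<le> card V"
    and l: "3 * (real K + real (card V) / real (s + 1)) * ln (32 * real s + 26) \<le> real l"
  shows "card {relation_vectors V K R D par col (2 * s) \<inter> P | P. additive_subgroup P} \<le> (card V ^ 2 * K + 1) ^ l"
proof -
  define I :: "(nat + 'v) set" where "I = Inl ` {..<K} \<union> Inr ` (R - D)"
  define Q where "Q = relation_vectors V K R D par col (2 * s)"
  have fRD: "finite (R - D)" using V R finite_subset by blast
  then have fI: "finite I" by (simp add: I_def)
  have "card I = K + card (R - D)"
    unfolding I_def using fRD by (subst card_Un_disjoint) (auto simp: card_image)
  moreover have "real (card (R - D)) \<le> real (card V) / real (s + 1)"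
  proof -
    have "real (card (R - D) * (s + 1)) \<le> real (card V)" using card of_nat_le_iff by blast
    then show ?thesis by (simp add: field_simps)
  qed
  ultimately have cI: "real (card I) \<le> real K + real (card V) / real (s + 1)" by simp
  have "card {Q \<inter> P | P. additive_subgroup P} \<le> (card Q + 1) ^ l"
  \<comment> \<open>Two formal labels of norm at most \<open>2 * s + 1\<close> and one unit vector
    give norm \<open>4 * s + 3\<close>, and
    \<open>8 * (4 * s + 3) + 2 = 32 * s + 26\<close>.\<close>
  proof (rule card_subgroup_traces_le[OF fI, where B = "4 * s + 3"])
    show "finite Q" unfolding Q_def by (rule card_relation_vectors_le(1)[OF V])
    fix x assume "x \<in> Q"
    then obtain u v c where uvc: "x = relation_vector R par col (2 * s) u v c" "u \<in> V" "v \<in> V" "c < K"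
        "tree_root R par (2 * s) u \<in> R - D" "tree_root R par (2 * s) v \<in> R - D"
      unfolding Q_def relation_vectors_def by blast
    show "x i = 0" if "i \<notin> I" for i
    proof -
      have "formal_label R par col (2 * s) u i = 0" "formal_label R par col (2 * s) v i = 0"
        using that uvc by (auto intro!: formal_label_support[OF par col] simp: I_def)
      moreover have "ivec (Inl c) i = 0" using that uvc by (auto simp: I_def ivec_def)
      ultimately show ?thesis using uvc by (simp add: relation_vector_def)
    qed
    have "(\<Sum>i\<in>I. \<bar>x i\<bar>) \<le> ((int (2 * s) + 1) + (int (2 * s) + 1)) + 1"
      unfolding uvc(1) relation_vector_def
      by (intro sum_abs_diff_le formal_label_norm sum_abs_ivec_le fI)
    then show "(\<Sum>i\<in>I. \<bar>x i\<bar>) \<le> int (4 * s + 3)" by simp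
  next
    have "3 * real (card I) * ln (8 * real (4 * s + 3) + 2) \<le> 3 * (real K + real (card V) / real (s + 1)) * ln (32 * real s + 26)"
      using cI by (intro mult_mono) (auto simp: algebra_simps)
    then show "3 * real (card I) * ln (8 * real (4 * s + 3) + 2) \<le> real l" using l by simp
  qed auto
  also have "\<dots> \<le> (card V ^ 2 * K + 1) ^ l"
    unfolding Q_def using card_relation_vectors_le(2)[OF V] by (intro power_mono) auto
  finally show ?thesis unfolding Q_def .
qed

section \<open>Counting encodable graphs\<close>

lemma finite_sum_graph: "finite V \<Longrightarrow> finite (sum_graph V K R D par col i X)"
  by (rule finite_subset[of _ "Pow V"]) (auto simp: sum_graph_def)

lemma card_UN_le_mult:
  assumes "finite I" "card I \<le> a" "\<And>i. i \<in> I \<Longrightarrow> card (F i) \<le> b"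
  shows "card (\<Union>i\<in>I. F i) \<le> a * (b::nat)"
proof -
  have "card (\<Union>i\<in>I. F i) \<le> (\<Sum>i\<in>I. card (F i))" by (rule card_UN_le[OF assms(1)])
  also have "\<dots> \<le> (\<Sum>i\<in>I. b)" by (intro sum_mono assms)
  also have "\<dots> \<le> a * b" using assms by simp
  finally show ?thesis .
qed

text \<open>A union bound over the code: \<open>2 ^ n\<close> choices each for \<open>R\<close> and
  \<open>D\<close>, then \<open>n ^ t * K ^ t\<close> for parents and colours of the
  \<open>t\<close> vertices that are not roots, then the trace, and finally the \<open>m - t\<close>
  edges outside the forest.\<close>

lemma card_encodable_le:
  fixes V :: "'v set" and b :: nat
  assumes V: "finite V"
    and l: "3 * (real K + real (card V) / real (s + 1)) * ln (32 * real s + 26) \<le> real l"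
    and b: "\<And>t. t \<le> card V \<Longrightarrow> card V ^ t * K ^ t * ((card V * K div 2) choose (m - t)) \<le> b"
  shows "card {E. E \<subseteq> pairs V \<and> card E = m \<and> encodable V K s E} \<le> 4 ^ card V * ((card V ^ 2 * K + 1) ^ l * b)"
proof -
  define n where "n = card V"
  define Q where "Q = (\<lambda>R D par col. relation_vectors V K R D par col (2 * s))"
  define G where "G = (\<lambda>R D par col X. sum_graph V K R D par col (2 * s) X)"
  define T where "T = (\<lambda>R par. tree_edges V R par)"
  define Xs where "Xs = (\<lambda>R D par col. {X \<in> {Q R D par col \<inter> P | P. additive_subgroup P}.
      card (T R par) = card (V - R) \<and> 2 * card (G R D par col X) \<le> card V * K})"
  \<comment> \<open>Given the code, \<open>E\<close> is fixed by its edges outside the forest, which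
    lie in the rebuilt graph.\<close>
  define Es where "Es = (\<lambda>R D par col X. (\<union>) (T R par) ` {E'. E' \<subseteq> G R D par col X \<and> card E' = m - card (V - R)})"
  define Ds where "Ds = (\<lambda>R :: 'v set. {D. D \<subseteq> R \<and> card (R - D) * (s + 1) \<le> card V})"
  have fR: "finite R" if "R \<in> Pow V" for R using that V finite_subset by blast
  have "{E. E \<subseteq> pairs V \<and> card E = m \<and> encodable V K s E} \<subseteq>
    (\<Union>R\<in>Pow V. \<Union>D\<in>Ds R. \<Union>par\<in>V - R \<rightarrow>\<^sub>E V. \<Union>col\<in>V - R \<rightarrow>\<^sub>E {..<K}. \<Union>X\<in>Xs R D par col. Es R D par col X)"
    (is "_ \<subseteq> ?U")
  proof
    fix E assume "E \<in> {E. E \<subseteq> pairs V \<and> card E = m \<and> encodable V K s E}"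
    then have E: "E \<subseteq> pairs V" "card E = m" "encodable V K s E" by auto
    from E(3) obtain R D par col P where *: "R \<subseteq> V" "D \<subseteq> R" "par \<in> V - R \<rightarrow>\<^sub>E V" "col \<in> V - R \<rightarrow>\<^sub>E {..<K}"
        "card (R - D) * (s + 1) \<le> card V" "additive_subgroup P"
        "T R par \<subseteq> E" "card (T R par) = card (V - R)"
        "E - T R par \<subseteq> G R D par col (Q R D par col \<inter> P)"
        "2 * card (G R D par col (Q R D par col \<inter> P)) \<le> card V * K"
      unfolding encodable_def T_def G_def Q_def by blast
    have "finite E" using E(1) finite_pairs[OF V] finite_subset by blast
    then have "card (E - T R par) = m - card (V - R)"
      using *(7,8) E(2) by (simp add: card_Diff_subset finite_subset)
    moreover have "E = T R par \<union> (E - T R par)" using *(7) by blast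
    ultimately have "E \<in> Es R D par col (Q R D par col \<inter> P)" unfolding Es_def using *(9) by blast
    moreover have "Q R D par col \<inter> P \<in> Xs R D par col" unfolding Xs_def using * by blast
    moreover have "D \<in> Ds R" using * by (simp add: Ds_def)
    ultimately show "E \<in> ?U" using * by blast
  qed
  moreover have fin: "finite (Xs R D par col)" "finite (Es R D par col X)" "finite (V - R \<rightarrow>\<^sub>E V)" "finite (V - R \<rightarrow>\<^sub>E {..<K})" for R D par col X
  proof -
    have "Xs R D par col \<subseteq> Pow (Q R D par col)" by (auto simp: Xs_def)
    moreover have "finite (Q R D par col)" unfolding Q_def by (rule card_relation_vectors_le(1)[OF V])
    ultimately show "finite (Xs R D par col)" using finite_subset by blast
    have "finite (G R D par col X)" unfolding G_def by (rule finite_sum_graph[OF V])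
    then show "finite (Es R D par col X)" unfolding Es_def by simp
  qed (use V in \<open>auto intro: finite_PiE\<close>)
  moreover have finD: "finite (Ds R)" if "R \<in> Pow V" for R
    by (rule finite_subset[of _ "Pow R"]) (use fR[OF that] in \<open>auto simp: Ds_def\<close>)
  ultimately have "card {E. E \<subseteq> pairs V \<and> card E = m \<and> encodable V K s E} \<le> card ?U"
    by (intro card_mono finite_UN_I) (auto simp: V)
  also have "\<dots> \<le> 2 ^ n * (2 ^ n * ((n ^ 2 * K + 1) ^ l * b))"
  proof (rule card_UN_le_mult)
    fix R assume R: "R \<in> Pow V"
    define t where "t = card (V - R)"
    have tn: "t \<le> card V" unfolding t_def using V by (intro card_mono) auto
    show "card (\<Union>D\<in>Ds R. \<Union>par\<in>V - R \<rightarrow>\<^sub>E V. \<Union>col\<in>V - R \<rightarrow>\<^sub>E {..<K}. \<Union>X\<in>Xs R D par col. Es R D par col X)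
        \<le> 2 ^ n * ((n ^ 2 * K + 1) ^ l * b)"
    proof (rule card_UN_le_mult[OF finD[OF R]])
      have "card (Ds R) \<le> card (Pow R)" using fR[OF R] by (intro card_mono) (auto simp: Ds_def)
      also have "\<dots> \<le> 2 ^ n" using R V by (auto simp: card_Pow fR n_def intro!: power_increasing card_mono)
      finally show "card (Ds R) \<le> 2 ^ n" .
      fix D assume D: "D \<in> Ds R"
      have "card (\<Union>par\<in>V - R \<rightarrow>\<^sub>E V. \<Union>col\<in>V - R \<rightarrow>\<^sub>E {..<K}. \<Union>X\<in>Xs R D par col. Es R D par col X)
          \<le> n ^ t * (K ^ t * ((n ^ 2 * K + 1) ^ l * ((n * K div 2) choose (m - t))))"
      proof (rule card_UN_le_mult[OF fin(3)])
        show "card (V - R \<rightarrow>\<^sub>E V) \<le> n ^ t" using V by (simp add: card_PiE n_def t_def)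
        fix par assume par: "par \<in> V - R \<rightarrow>\<^sub>E V"
        show "card (\<Union>col\<in>V - R \<rightarrow>\<^sub>E {..<K}. \<Union>X\<in>Xs R D par col. Es R D par col X)
            \<le> K ^ t * ((n ^ 2 * K + 1) ^ l * ((n * K div 2) choose (m - t)))"
        proof (rule card_UN_le_mult[OF fin(4)])
          show "card (V - R \<rightarrow>\<^sub>E {..<K}) \<le> K ^ t" using V by (simp add: card_PiE t_def)
          fix col assume col: "col \<in> V - R \<rightarrow>\<^sub>E {..<K}"
          show "card (\<Union>X\<in>Xs R D par col. Es R D par col X) \<le> (n ^ 2 * K + 1) ^ l * ((n * K div 2) choose (m - t))"
          proof (rule card_UN_le_mult[OF fin(1)])
            have "finite {Q R D par col \<inter> P | P. additive_subgroup P}"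
              by (rule finite_subset[of _ "Pow (Q R D par col)"])
                (auto simp: Q_def card_relation_vectors_le(1)[OF V])
            then have "card (Xs R D par col) \<le> card {Q R D par col \<inter> P | P. additive_subgroup P}"
              by (rule card_mono) (auto simp: Xs_def)
            also have "\<dots> \<le> (n ^ 2 * K + 1) ^ l"
              unfolding Q_def n_def using R par col D
              by (intro card_relation_traces_le V l) (auto simp: Ds_def PiE_def)
            finally show "card (Xs R D par col) \<le> (n ^ 2 * K + 1) ^ l" .
            fix X assume X: "X \<in> Xs R D par col"
            have fG: "finite (G R D par col X)" unfolding G_def by (rule finite_sum_graph[OF V])
            then have "card (Es R D par col X) \<le> card {E'. E' \<subseteq> G R D par col X \<and> card E' = m - card (V - R)}"
              unfolding Es_def by (intro card_image_le) simp
            also have "\<dots> = card (G R D par col X) choose (m - t)"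
              unfolding t_def by (rule n_subsets[OF fG])
            also have "\<dots> \<le> (n * K div 2) choose (m - t)"
              using X by (intro binomial_right_mono) (auto simp: Xs_def n_def)
            finally show "card (Es R D par col X) \<le> (n * K div 2) choose (m - t)" .
          qed
        qed
      qed
      also have "\<dots> = (n ^ 2 * K + 1) ^ l * (n ^ t * K ^ t * ((n * K div 2) choose (m - t)))"
        by (simp only: mult_ac)
      also have "\<dots> \<le> (n ^ 2 * K + 1) ^ l * b"
        using b[OF tn] unfolding n_def by (rule mult_left_mono) simp
      finally show "card (\<Union>par\<in>V - R \<rightarrow>\<^sub>E V. \<Union>col\<in>V - R \<rightarrow>\<^sub>E {..<K}. \<Union>X\<in>Xs R D par col. Es R D par col X)
          \<le> (n ^ 2 * K + 1) ^ l * b" .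
    qed
  qed (use V in \<open>auto simp: card_Pow n_def\<close>)
  also have "\<dots> = 4 ^ n * ((n ^ 2 * K + 1) ^ l * b)"
    by (simp add: power_mult_distrib[symmetric] mult.assoc[symmetric])
  finally show ?thesis by (simp add: n_def)
qed

section \<open>Evaluation of integer vectors in an abelian group, and its kernel\<close>

definition weighted_product :: "('h, 'm) monoid_scheme \<Rightarrow> ('i \<Rightarrow> 'h) \<Rightarrow> 'i set \<Rightarrow> ('i \<Rightarrow> int) \<Rightarrow> 'h" where
  "weighted_product H g I x = finprod H (\<lambda>i. g i [^]\<^bsub>H\<^esub> x i) I"

context comm_group
begin

lemma weighted_product_closed:
  "g \<in> I \<rightarrow> carrier G \<Longrightarrow> weighted_product G g I x \<in> carrier G"
  unfolding weighted_product_def by (rule finprod_closed) auto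

lemma weighted_product_add:
  assumes "g \<in> I \<rightarrow> carrier G"
  shows "weighted_product G g I (x + y) = weighted_product G g I x \<otimes> weighted_product G g I y"
proof -
  have "weighted_product G g I (x + y) = finprod G (\<lambda>i. g i [^] x i \<otimes> g i [^] y i) I"
    unfolding weighted_product_def
    by (intro finprod_cong') (use assms in \<open>auto simp: int_pow_mult Pi_def\<close>)
  also have "\<dots> = weighted_product G g I x \<otimes> weighted_product G g I y"
    unfolding weighted_product_def using assms by (intro finprod_multf) auto
  finally show ?thesis .
qed

lemma weighted_product_diff:
  assumes "g \<in> I \<rightarrow> carrier G"
  shows "weighted_product G g I (x - y) \<otimes> weighted_product G g I y = weighted_product G g I x"
  using weighted_product_add[OF assms, of "x - y" y] by simp

lemma weighted_product_ivec:
  assumes "g \<in> I \<rightarrow> carrier G" "finite I" "i \<in> I"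
  shows "weighted_product G g I (ivec i) = g i"
proof -
  have "weighted_product G g I (ivec i) = finprod G (\<lambda>j. if i = j then g j else \<one>) I"
    unfolding weighted_product_def
    by (intro finprod_cong') (use assms in \<open>auto simp: ivec_def Pi_def\<close>)
  also have "\<dots> = g i" using assms by (intro finprod_singleton) auto
  finally show ?thesis .
qed

lemma additive_subgroup_kernel:
  assumes "g \<in> I \<rightarrow> carrier G"
  shows "additive_subgroup {x. weighted_product G g I x = \<one>}"
  unfolding additive_subgroup_def
proof (intro conjI ballI)
  have "weighted_product G g I 0 = finprod G (\<lambda>i. \<one>) I"
    unfolding weighted_product_def by (intro finprod_cong') auto
  then show "0 \<in> {x. weighted_product G g I x = \<one>}" by simp
  fix x y assume xy: "x \<in> {x. weighted_product G g I x = \<one>}" "y \<in> {x. weighted_product G g I x = \<one>}"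
  then show "x + y \<in> {x. weighted_product G g I x = \<one>}"
    using weighted_product_add[OF assms, of x y] by simp
  show "x - y \<in> {x. weighted_product G g I x = \<one>}"
    using weighted_product_diff[OF assms, of x y] weighted_product_closed[OF assms, of "x - y"] xy by simp
qed

end

text \<open>Take for \<open>P\<close> the kernel of the evaluation that sends the coordinates to the
  actual sums and labels. Formal labels then evaluate to labels, so the rebuilt graph contains
  \<open>E\<close>, and injectivity of \<open>A\<close> bounds its degrees.\<close>

lemma small_edge_sums_encodable:
  fixes H :: "('h, 'm) monoid_scheme" and V :: "'v set"
  assumes H: "comm_group H" and V: "finite V" and E: "E \<subseteq> pairs V"
    and A: "A \<in> labellings H V" and card: "card (edge_sums H E A) \<le> K" and s: "s \<le> K"
  shows "encodable V K s E"
proof -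
  interpret comm_group H by fact
  have AC: "A v \<in> carrier H" if "v \<in> V" for v using A that by (auto simp: labellings_def)
  have Ainj: "inj_on A V" using A by (auto simp: labellings_def)
  have EV: "u \<in> V" "v \<in> V" if "{u, v} \<in> E" for u v using that E by (auto simp: pairs_def)
  have SC: "edge_sums H E A \<subseteq> carrier H" using EV AC by (auto simp: edge_sums_def)
  have "finite (edge_sums H E A)"
  proof (rule finite_subset)
    show "edge_sums H E A \<subseteq> (\<lambda>(u, v). A u \<otimes>\<^bsub>H\<^esub> A v) ` (V \<times> V)" using EV by (auto simp: edge_sums_def)
  qed (use V in simp)
  then obtain h where h: "bij_betw h {0..<card (edge_sums H E A)} (edge_sums H E A)"
    using ex_bij_betw_nat_finite by blast
  \<comment> \<open>Numbers beyond the actual edge sums stand for the identity, so that exactly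
    \<open>K\<close> colours are available. This can only enlarge the rebuilt graph, whose degrees
    remain bounded by \<open>K\<close>.\<close>
  define sv where "sv = (\<lambda>c. if c < card (edge_sums H E A) then h c else \<one>\<^bsub>H\<^esub>)"
  have svC: "sv c \<in> carrier H" for c
    using bij_betw_imp_surj_on[OF h] SC by (auto simp: sv_def)
  have sv: "\<exists>c<K. A u \<otimes>\<^bsub>H\<^esub> A v = sv c" if "{u, v} \<in> E" for u v
  proof -
    have "A u \<otimes>\<^bsub>H\<^esub> A v \<in> edge_sums H E A" using that by (auto simp: edge_sums_def)
    then have "A u \<otimes>\<^bsub>H\<^esub> A v \<in> h ` {0..<card (edge_sums H E A)}" using h by (simp add: bij_betw_def)
    then obtain c where "c < card (edge_sums H E A)" "A u \<otimes>\<^bsub>H\<^esub> A v = h c" by auto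
    then show ?thesis using card by (intro exI[of _ c]) (simp add: sv_def)
  qed
  obtain R D dep par where R: "R \<subseteq> V" and D: "D \<subseteq> R"
    and dep0: "\<And>v. v \<in> R \<Longrightarrow> dep v = 0"
    and par: "par \<in> V - R \<rightarrow>\<^sub>E V"
    and dep: "\<And>v. v \<in> V - R \<Longrightarrow> {v, par v} \<in> E \<and> dep v = Suc (dep (par v))"
    and dep_le: "\<And>v. v \<in> V \<Longrightarrow> dep v \<le> 2 * s"
    and root: "\<And>v. v \<in> V \<Longrightarrow> tree_root R par (2 * s) v \<in> R"
    and cRD: "card (R - D) * (s + 1) \<le> card V"
    and small: "\<And>u v. {u, v} \<in> E \<Longrightarrow> tree_root R par (2 * s) u \<in> D \<Longrightarrow>
        tree_root R par (2 * s) v = tree_root R par (2 * s) u"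
    and small_card: "\<And>r. r \<in> D \<Longrightarrow> card {v \<in> V. tree_root R par (2 * s) v = r} \<le> s"
    by (rule shallow_spanning_forest[OF V E, of s], rule that) assumption+
  have parV: "par v \<in> V" if "v \<in> V - R" for v using par that by auto
  define col where "col = (\<lambda>v\<in>V - R. SOME c. c < K \<and> A v \<otimes>\<^bsub>H\<^esub> A (par v) = sv c)"
  have col: "col v < K \<and> A v \<otimes>\<^bsub>H\<^esub> A (par v) = sv (col v)" if "v \<in> V - R" for v
    unfolding col_def restrict_apply'[OF that] by (rule someI_ex[OF sv]) (use dep[OF that] in simp)
  have colP: "col \<in> V - R \<rightarrow>\<^sub>E {..<K}" using col by (auto simp: PiE_def Pi_def col_def)
  \<comment> \<open>All vertices get a coordinate here, as any root may occur in a formal label. The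
    smaller coordinate set matters only for counting traces.\<close>
  define I :: "(nat + 'v) set" where "I = Inl ` {..<K} \<union> Inr ` V"
  define g where "g = (\<lambda>i :: nat + 'v. case i of Inl c \<Rightarrow> sv c | Inr v \<Rightarrow> A v)"
  have fI: "finite I" using V by (simp add: I_def)
  have g: "g \<in> I \<rightarrow> carrier H" using svC AC by (auto simp: I_def g_def)
  define \<phi> where "\<phi> = weighted_product H g I"
  define P where "P = {x. \<phi> x = \<one>\<^bsub>H\<^esub>}"
  have P: "additive_subgroup P" unfolding P_def \<phi>_def by (rule additive_subgroup_kernel[OF g])
  have \<phi>C: "\<phi> x \<in> carrier H" for x unfolding \<phi>_def by (rule weighted_product_closed[OF g])
  have \<phi>Inl: "\<phi> (ivec (Inl c)) = sv c" if "c < K" for c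
    using weighted_product_ivec[OF g fI, of "Inl c"] that by (simp add: \<phi>_def I_def g_def)
  have \<phi>Inr: "\<phi> (ivec (Inr v)) = A v" if "v \<in> V" for v
    using weighted_product_ivec[OF g fI, of "Inr v"] that by (simp add: \<phi>_def I_def g_def)
  \<comment> \<open>Induction up the tree: evaluating the recursion solves the equation of the edge
    to the parent. The counter must cover the depth, since at counter 0 the vertex stands for
    itself.\<close>
  have label: "\<phi> (formal_label R par col i v) = A v" if "v \<in> V" "dep v \<le> i" for i v
    using that
  proof (induction i arbitrary: v)
    case (Suc i)
    show ?case
    proof (cases "v \<in> R")
      case False
      then have v: "v \<in> V - R" using Suc by auto
      then have IH: "\<phi> (formal_label R par col i (par v)) = A (par v)"
        using Suc.IH[OF parV[OF v]] Suc.prems dep[OF v] by simp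
      have "\<phi> (ivec (Inl (col v)) - formal_label R par col i (par v)) \<otimes>\<^bsub>H\<^esub> A (par v) = A v \<otimes>\<^bsub>H\<^esub> A (par v)"
        using weighted_product_diff[OF g] IH \<phi>Inl col[OF v] by (metis \<phi>_def)
      then have "\<phi> (ivec (Inl (col v)) - formal_label R par col i (par v)) = A v"
        using Suc.prems AC parV[OF v] \<phi>C by simp
      moreover have "formal_label R par col (Suc i) v = ivec (Inl (col v)) - formal_label R par col i (par v)"
        using False by (intro ext) simp
      ultimately show ?thesis by metis
    qed (use \<phi>Inr Suc.prems in simp)
  qed (simp add: \<phi>Inr)
  have rel: "relation_vector R par col (2 * s) u v c \<in> P \<longleftrightarrow> A u \<otimes>\<^bsub>H\<^esub> A v = sv c"
    if "u \<in> V" "v \<in> V" "c < K" for u v c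
  proof -
    have "\<phi> (relation_vector R par col (2 * s) u v c) \<otimes>\<^bsub>H\<^esub> sv c = A u \<otimes>\<^bsub>H\<^esub> A v"
      unfolding relation_vector_def
      using weighted_product_diff[OF g] weighted_product_add[OF g] label[OF that(1) dep_le[OF that(1)]]
        label[OF that(2) dep_le[OF that(2)]] \<phi>Inl[OF that(3)] by (metis \<phi>_def)
    moreover have "x = \<one>\<^bsub>H\<^esub> \<longleftrightarrow> x \<otimes>\<^bsub>H\<^esub> sv c = sv c" if "x \<in> carrier H" for x
      using that svC by simp
    ultimately show ?thesis using \<phi>C unfolding P_def by auto
  qed
  define rt where "rt = tree_root R par (2 * s)"
  define X where "X = relation_vectors V K R D par col (2 * s) \<inter> P"
  define \<Gamma> where "\<Gamma> = sum_graph V K R D par col (2 * s) X"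
  have X: "relation_vector R par col (2 * s) u v c \<in> X"
    if "u \<in> V" "v \<in> V" "c < K" "rt u \<in> R - D" "rt v \<in> R - D" "A u \<otimes>\<^bsub>H\<^esub> A v = sv c" for u v c
    using that rel unfolding X_def relation_vectors_def rt_def by blast
  have E\<Gamma>: "E \<subseteq> \<Gamma>"
  proof
    fix e assume e: "e \<in> E"
    then have "e \<in> pairs V" using E by blast
    then obtain u v where uv: "e = {u, v}" "u \<in> V" "v \<in> V" "u \<noteq> v" by (rule pairs_elim)
    have E2: "{u, v} \<in> E" "{v, u} \<in> E" using e uv by (auto simp: insert_commute)
    have "rt u \<in> D \<and> rt v = rt u \<or> rt u \<in> R - D \<and> rt v \<in> R - D"
      using small[OF E2(1)] small[OF E2(2)] root uv by (auto simp: rt_def)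
    moreover have "\<exists>c<K. relation_vector R par col (2 * s) u v c \<in> X" if "rt u \<in> R - D" "rt v \<in> R - D"
      using sv[OF E2(1)] X[OF uv(2,3)] that by blast
    ultimately show "e \<in> \<Gamma>" unfolding \<Gamma>_def sum_graph_def rt_def uv(1) using uv by blast
  qed
  have \<Gamma>pairs: "\<Gamma> \<subseteq> pairs V" unfolding \<Gamma>_def sum_graph_def by (auto simp: pairs_iff)
  \<comment> \<open>The unordered edge may be witnessed by either orientation, and commutativity of
    the group makes the condition symmetric.\<close>
  have \<Gamma>iff: "rt u \<in> D \<and> rt v = rt u \<or> (rt u \<in> R - D \<and> (\<exists>c<K. A u \<otimes>\<^bsub>H\<^esub> A v = sv c))"
    if "{u, v} \<in> \<Gamma>" for u v
  proof -
    have uv: "u \<in> V" "v \<in> V" using that \<Gamma>pairs by (auto simp: pairs_def)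
    define W where "W = (\<lambda>a b. rt a \<in> D \<and> rt b = rt a \<or> rt a \<in> R - D \<and> rt b \<in> R - D \<and>
         (\<exists>c<K. relation_vector R par col (2 * s) a b c \<in> X))"
    have "\<exists>a b. {u, v} = {a, b} \<and> a \<in> V \<and> b \<in> V \<and> a \<noteq> b \<and> W a b"
      using that unfolding \<Gamma>_def sum_graph_def W_def rt_def mem_Collect_eq .
    then obtain a b where ab: "{u, v} = {a, b}" "a \<in> V" "b \<in> V" and *: "W a b" by blast
    have "A a \<otimes>\<^bsub>H\<^esub> A b = sv c" if "c < K" "relation_vector R par col (2 * s) a b c \<in> X" for c
      using that rel[OF ab(2,3)] by (simp add: X_def)
    then have "rt a \<in> D \<and> rt b = rt a \<or> rt a \<in> R - D \<and> rt b \<in> R - D \<and> (\<exists>c<K. A a \<otimes>\<^bsub>H\<^esub> A b = sv c)"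
      using * unfolding W_def by blast
    moreover have "A a \<otimes>\<^bsub>H\<^esub> A b = A b \<otimes>\<^bsub>H\<^esub> A a" using AC ab by (simp add: m_comm)
    ultimately show ?thesis using ab(1) by (auto simp: doubleton_eq_iff)
  qed
  \<comment> \<open>In a clique the degree is at most the component size, hence at most
    \<open>s \<le> K\<close>. Elsewhere different neighbours of \<open>u\<close> give different
    sums, of which there are at most \<open>K\<close>.\<close>
  have deg: "deg \<Gamma> u \<le> K" if "u \<in> V" for u
  proof (cases "rt u \<in> D")
    case True
    have "{v. {u, v} \<in> \<Gamma>} \<subseteq> {v \<in> V. rt v = rt u}"
      using \<Gamma>iff True \<Gamma>pairs by (auto simp: pairs_def)
    then have "card {v. {u, v} \<in> \<Gamma>} \<le> card {v \<in> V. rt v = rt u}" by (intro card_mono) (use V in auto)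
    also have "\<dots> \<le> s" using small_card True by (simp add: rt_def)
    finally show ?thesis using s deg_card_neighbours[OF \<Gamma>pairs] by simp
  next
    case False
    have "card {v. {u, v} \<in> \<Gamma>} \<le> card (sv ` {..<K})"
    proof (rule card_inj_on_le)
      have sub: "{v. {u, v} \<in> \<Gamma>} \<subseteq> V" using \<Gamma>pairs by (auto simp: pairs_def)
      show "inj_on (\<lambda>v. A u \<otimes>\<^bsub>H\<^esub> A v) {v. {u, v} \<in> \<Gamma>}"
      proof (rule inj_onI)
        fix v w assume vw: "v \<in> {v. {u, v} \<in> \<Gamma>}" "w \<in> {v. {u, v} \<in> \<Gamma>}" "A u \<otimes>\<^bsub>H\<^esub> A v = A u \<otimes>\<^bsub>H\<^esub> A w"
        then have "v \<in> V" "w \<in> V" using sub by auto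
        then have "A v = A w" using vw(3) AC that by simp
        then show "v = w" using Ainj \<open>v \<in> V\<close> \<open>w \<in> V\<close> by (auto simp: inj_on_def)
      qed
      show "(\<lambda>v. A u \<otimes>\<^bsub>H\<^esub> A v) ` {v. {u, v} \<in> \<Gamma>} \<subseteq> sv ` {..<K}"
        using \<Gamma>iff False by blast
    qed simp
    also have "\<dots> \<le> K" using card_image_le[of "{..<K}" sv] by simp
    finally show ?thesis using deg_card_neighbours[OF \<Gamma>pairs] by simp
  qed
  have "2 * card \<Gamma> = (\<Sum>v\<in>V. deg \<Gamma> v)" using sum_deg[OF V \<Gamma>pairs] by simp
  also have "\<dots> \<le> (\<Sum>v\<in>V. K)" by (intro sum_mono deg)
  finally have "2 * card \<Gamma> \<le> card V * K" by simp
  moreover have "tree_edges V R par \<subseteq> E" using dep by (auto simp: tree_edges_def)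
  moreover have "card (tree_edges V R par) = card (V - R)"
    unfolding tree_edges_def
  proof (rule card_image, rule inj_onI)
    fix v w assume vw: "v \<in> V - R" "w \<in> V - R" "{v, par v} = {w, par w}"
    show "v = w"
    proof (rule ccontr)
      assume "v \<noteq> w"
      then have "par v = w" "par w = v" using vw(3) by (auto simp: doubleton_eq_iff)
      then show False using dep[OF vw(1)] dep[OF vw(2)] by simp
    qed
  qed
  ultimately show ?thesis
    unfolding encodable_def
    by (intro exI[of _ R] exI[of _ D] exI[of _ par] exI[of _ col] exI[of _ P] conjI)
      (use R D par colP cRD P E\<Gamma> in \<open>auto simp: \<Gamma>_def X_def\<close>)
qed

section \<open>Comparison of binomial coefficients\<close>

lemma Suc_mult_choose_Suc: "Suc j * (N choose Suc j) = (N - j) * (N choose j)"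
  by (simp only: binomial_absorption binomial_absorb_comp)

text \<open>Each factor \<open>(M - i) / (N - i)\<close> of the quotient of the two binomial
  coefficients is at most \<open>M / N\<close>.\<close>

lemma choose_mult_power_le:
  assumes "M \<le> N"
  shows "(M choose j) * N ^ j \<le> M ^ j * (N choose j)"
proof (induction j)
  case (Suc j)
  have "Suc j * ((M choose Suc j) * N ^ Suc j) = ((M choose j) * N ^ j) * ((M - j) * N)"
    using Suc_mult_choose_Suc[of j M] by (metis (no_types, lifting) mult.assoc mult.commute power_Suc)
  also have "\<dots> \<le> (M ^ j * (N choose j)) * (M * (N - j))"
  proof (rule mult_mono[OF Suc])
    show "(M - j) * N \<le> M * (N - j)"
      using diff_le_mono2[OF mult_le_mono1[OF assms, of j], of "M * N"]
      by (simp add: diff_mult_distrib diff_mult_distrib2 mult.commute)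
  qed auto
  also have "\<dots> = Suc j * (M ^ Suc j * (N choose Suc j))"
    using Suc_mult_choose_Suc[of j N] by (metis (no_types, lifting) mult.assoc mult.commute power_Suc)
  finally show ?case using Suc_mult_le_cancel1 by blast
qed simp

text \<open>Lowering the index by one costs a factor of at most \<open>m / (N - m + 1)\<close>. The
  summand 1 keeps the denominator positive even for \<open>m = N\<close>.\<close>

lemma choose_diff_le:
  assumes "m \<le> N" "t \<le> m"
  shows "(N choose (m - t)) * (N - m + 1) ^ t \<le> m ^ t * (N choose m)"
  using assms(2)
proof (induction t)
  case (Suc t)
  define j where "j = m - Suc t"
  have mj: "m - t = Suc j" using Suc by (simp add: j_def)
  have "(N choose j) * (N - m + 1) \<le> (N choose j) * (N - j)"
    using assms Suc by (intro mult_left_mono) (auto simp: j_def)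
  also have "\<dots> = Suc j * (N choose Suc j)"
    using Suc_mult_choose_Suc[of j N] by (simp only: mult.commute)
  also have "\<dots> \<le> m * (N choose (m - t))" using mj by (intro mult_mono) auto
  finally have "(N choose j) * (N - m + 1) * (N - m + 1) ^ t \<le> m * (N choose (m - t)) * (N - m + 1) ^ t"
    by (rule mult_right_mono) simp
  also have "\<dots> \<le> m * (m ^ t * (N choose m))"
    using Suc by (simp add: mult.assoc)
  finally show ?case by (simp only: j_def mult_ac power_Suc)
qed simp

section \<open>The probability of a small sum number\<close>

text \<open>Confining \<open>m - t\<close> edges to the rebuilt graph yields only
  \<open>m - t\<close> factors \<open>\<theta>\<close>. The missing \<open>t\<close> factors come
  from the forest: since \<open>n * K = \<theta> * 2 * N\<close>, a parent and a colour together are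
  worth \<open>\<theta>\<close> times \<open>2 * N\<close>.\<close>

lemma encoding_count_le:
  fixes n K m t :: nat and Z :: real
  defines "N \<equiv> n choose 2"
  assumes n: "n \<ge> 2" and K: "K \<le> n - 1" and t: "t \<le> n" "n \<le> m" and m: "m \<le> N"
    and Z: "Z \<ge> 1" "2 * real N * real m / real (N - m + 1) \<le> Z"
  shows "real (n ^ t * K ^ t * ((n * K div 2) choose (m - t))) \<le> (real K / real (n - 1)) ^ m * Z ^ n * real (N choose m)"
proof -
  define \<theta> where "\<theta> = real K / real (n - 1)"
  define \<rho> where "\<rho> = real m / real (N - m + 1)"
  define M where "M = n * K div 2"
  have th: "\<theta> \<ge> 0" by (simp add: \<theta>_def)
  have "even (n * (n - 1))" by (cases n) auto
  then have N2: "2 * N = n * (n - 1)" unfolding N_def choose_two by (rule dvd_mult_div_cancel)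
  then have N2r: "2 * real N = real n * real (n - 1)" by (metis of_nat_mult of_nat_numeral)
  have Npos: "N > 0" using m t n by linarith
  have nK: "real n * real K = \<theta> * (2 * real N)" using n by (simp add: N2r \<theta>_def)
  have "n * K \<le> 2 * N" unfolding N2 using K by simp
  then have MN: "M \<le> N" by (simp add: M_def)
  have "real (2 * M) \<le> real (n * K)" unfolding M_def by (intro of_nat_mono) simp
  then have Mr: "real M \<le> \<theta> * real N" using nK by simp
  have 1: "real (M choose j) \<le> \<theta> ^ j * real (N choose j)" for j
  proof -
    have "real (M choose j) * real N ^ j \<le> real M ^ j * real (N choose j)"
      using choose_mult_power_le[OF MN, of j] by (metis of_nat_le_iff of_nat_mult of_nat_power)
    also have "\<dots> \<le> (\<theta> * real N) ^ j * real (N choose j)"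
      using Mr by (intro mult_right_mono power_mono) auto
    finally have "real (M choose j) * real N ^ j \<le> (\<theta> ^ j * real (N choose j)) * real N ^ j"
      by (simp add: power_mult_distrib mult_ac)
    then show ?thesis using Npos by simp
  qed
  have 2: "real (N choose (m - t)) \<le> \<rho> ^ t * real (N choose m)"
  proof -
    have "real (N choose (m - t)) * real (N - m + 1) ^ t \<le> real m ^ t * real (N choose m)"
      using choose_diff_le[OF m, of t] t by (metis le_trans of_nat_le_iff of_nat_mult of_nat_power)
    then show ?thesis by (simp add: \<rho>_def power_divide field_simps)
  qed
  have "real (n ^ t * K ^ t * (M choose (m - t))) = (real n * real K) ^ t * real (M choose (m - t))"
    by (simp add: power_mult_distrib)
  also have "\<dots> \<le> (real n * real K) ^ t * (\<theta> ^ (m - t) * (\<rho> ^ t * real (N choose m)))"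
    using order_trans[OF 1[of "m - t"] mult_left_mono[OF 2, of "\<theta> ^ (m - t)"]] th by (intro mult_left_mono) auto
  \<comment> \<open>What remains per tree edge is \<open>2 * N * \<rho>\<close>, which is bounded by
    \<open>Z\<close>.\<close>
  also have "\<dots> = (\<theta> ^ t * \<theta> ^ (m - t)) * (2 * real N * \<rho>) ^ t * real (N choose m)"
    unfolding nK by (simp add: power_mult_distrib mult_ac)
  also have "\<theta> ^ t * \<theta> ^ (m - t) = \<theta> ^ m" using t by (simp add: power_add[symmetric])
  also have "\<theta> ^ m * (2 * real N * \<rho>) ^ t * real (N choose m) \<le> \<theta> ^ m * Z ^ n * real (N choose m)"
  proof (intro mult_right_mono mult_left_mono)
    have "(2 * real N * \<rho>) ^ t \<le> Z ^ t" using Z by (intro power_mono) (auto simp: \<rho>_def)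
    also have "\<dots> \<le> Z ^ n" using Z t by (intro power_increasing) auto
    finally show "(2 * real N * \<rho>) ^ t \<le> Z ^ n" .
  qed (use th in auto)
  finally show ?thesis by (simp add: \<theta>_def M_def)
qed

section \<open>From counts to probabilities\<close>

lemma regular_graphs_eq_degree_class: "regular_graphs n d = degree_class {1..n} (\<lambda>_. d)"
  by (simp add: regular_graphs_def degree_class_def pairs_def deg_def)

lemma regular_edges_le:
  assumes "d < n" "n * d = 2 * m"
  shows "m \<le> n choose 2"
proof -
  have "2 * m \<le> n * (n - 1)" unfolding assms(2)[symmetric] using assms(1) by simp
  then show ?thesis by (simp add: choose_two)
qed

text \<open>Existence comes for free from the lower bound on the number of regular graphs, whose
  left-hand side is positive.\<close>

lemma regular_graphs_nonempty:
  assumes "0 < d" "d < n" "n * d = 2 * m"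
  shows "regular_graphs n d \<noteq> {}"
proof
  assume "regular_graphs n d = {}"
  then have "real ((n choose 2) choose m) \<le> 0"
    using card_regular_ge[of "{1..n}" d m] assms by (simp add: regular_graphs_eq_degree_class)
  then show False using regular_edges_le[OF assms(2,3)] by simp
qed

text \<open>The upper bound for encodable graphs is divided by the lower bound for regular graphs;
  the factor \<open>N choose m\<close> cancels.\<close>

lemma prob_small_sum_number_le:
  fixes n d m K s l :: nat and Z :: real
  defines "N \<equiv> n choose 2"
  assumes d: "3 \<le> d" "d < n" and m: "n * d = 2 * m" and K: "s \<le> K" "K \<le> n - 1"
    and l: "3 * (real K + real n / real (s + 1)) * ln (32 * real s + 26) \<le> real l"
    and Z: "Z \<ge> 1" "2 * real N * real m / real (N - m + 1) \<le> Z"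
  shows "measure_pmf.prob (random_regular_graph n d) {E. sum_number {1..n} E \<le> K}
    \<le> (exp 1 * (real d + 1)) ^ n * (4 ^ n * (real (n ^ 2 * K + 1) ^ l * ((real K / real (n - 1)) ^ m * Z ^ n)))"
proof -
  define V where "V = {1..n}"
  have V: "finite V" "card V = n" by (auto simp: V_def)
  define G where "G = regular_graphs n d"
  define B where "B = {E. E \<subseteq> pairs V \<and> card E = m \<and> encodable V K s E}"
  define \<beta> where "\<beta> = (real K / real (n - 1)) ^ m * Z ^ n"
  have Gd: "G = degree_class V (\<lambda>_. d)" by (simp add: G_def V_def regular_graphs_eq_degree_class)
  have fG: "finite G" unfolding G_def by (rule finite_regular_graphs)
  have neG: "G \<noteq> {}" unfolding G_def using d by (intro regular_graphs_nonempty[OF _ _ m]) auto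
  have cG: "real (card G) > 0" using fG neG by (simp add: card_gt_0_iff)
  have mN: "m \<le> N" unfolding N_def by (rule regular_edges_le[OF d(2) m])
  have nm: "n \<le> m"
  proof -
    have "n * 2 \<le> n * d" using d by (intro mult_left_mono) auto
    then show ?thesis using m by simp
  qed
  have fB: "finite B"
    by (rule finite_subset[of _ "Pow (pairs V)"]) (auto simp: B_def finite_pairs[OF V(1)])
  have "G \<inter> {E. sum_number V E \<le> K} \<subseteq> B"
  proof
    fix E assume "E \<in> G \<inter> {E. sum_number V E \<le> K}"
    then have E: "E \<subseteq> pairs V" "\<And>v. v \<in> V \<Longrightarrow> deg E v = d" "sum_number V E \<le> K"
      by (auto simp: Gd degree_class_def)
    have "2 * card E = n * d" using sum_deg[OF V(1) E(1)] E(2) V(2) by simp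
    then have cE: "card E = m" using m by simp
    have "\<And>e. e \<in> E \<Longrightarrow> e \<subseteq> V" using E(1) by (auto simp: pairs_def)
    then obtain H :: "nat monoid" and A where "comm_group H" "A \<in> labellings H V"
        "sum_number V E = card (edge_sums H E A)"
      using sum_number_attained[OF V(1)] by metis
    then have "encodable V K s E" using E K by (intro small_edge_sums_encodable[of H V E A] V) auto
    then show "E \<in> B" using E cE by (simp add: B_def)
  qed
  then have "real (card (G \<inter> {E. sum_number V E \<le> K})) \<le> real (card B)"
    using fB by (intro of_nat_mono card_mono)
  also have "\<dots> \<le> 4 ^ n * (real (n ^ 2 * K + 1) ^ l * (\<beta> * real (N choose m)))"
  proof -
    \<comment> \<open>A maximum over all forest sizes \<open>t\<close>, because the number of tree
      edges is not known in advance.\<close>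
    define b where "b = Max ((\<lambda>t. n ^ t * K ^ t * ((n * K div 2) choose (m - t))) ` {..n})"
    have "b \<in> (\<lambda>t. n ^ t * K ^ t * ((n * K div 2) choose (m - t))) ` {..n}"
      unfolding b_def by (intro Max_in) auto
    then obtain t where t: "t \<le> n" "b = n ^ t * K ^ t * ((n * K div 2) choose (m - t))" by auto
    have b: "real b \<le> \<beta> * real (N choose m)"
      unfolding t(2) \<beta>_def N_def using d K nm mN Z t(1) by (intro encoding_count_le) (auto simp: N_def)
    have "card B \<le> 4 ^ n * ((n ^ 2 * K + 1) ^ l * b)"
      unfolding B_def using card_encodable_le[OF V(1), of K s l m b] l
      by (simp add: V(2) b_def)
    then have "real (card B) \<le> real (4 ^ n * ((n ^ 2 * K + 1) ^ l * b))" by (rule of_nat_mono)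
    also have "\<dots> = 4 ^ n * (real (n ^ 2 * K + 1) ^ l * real b)" by simp
    also have "\<dots> \<le> 4 ^ n * (real (n ^ 2 * K + 1) ^ l * (\<beta> * real (N choose m)))"
      using b by (intro mult_left_mono) auto
    finally show ?thesis .
  qed
  also have "\<dots> \<le> 4 ^ n * (real (n ^ 2 * K + 1) ^ l * (\<beta> * ((exp 1 * (real d + 1)) ^ n * real (card G))))"
  proof -
    have "real (N choose m) \<le> (exp 1 * (real d + 1)) ^ n * real (card G)"
      using card_regular_ge[OF V(1), of d m] d m by (simp add: V(2) N_def Gd)
    moreover have "\<beta> \<ge> 0" using Z by (simp add: \<beta>_def)
    ultimately show ?thesis by (intro mult_left_mono) auto
  qed
  finally have "real (card (G \<inter> {E. sum_number V E \<le> K})) / real (card G)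
      \<le> (exp 1 * (real d + 1)) ^ n * (4 ^ n * (real (n ^ 2 * K + 1) ^ l * \<beta>))"
    using cG by (simp add: divide_le_eq mult_ac)
  moreover have "measure_pmf.prob (random_regular_graph n d) {E. sum_number {1..n} E \<le> K}
      = real (card (G \<inter> {E. sum_number V E \<le> K})) / real (card G)"
    unfolding random_regular_graph_def V_def using measure_pmf_of_set[OF neG fG] by (simp add: G_def)
  ultimately show ?thesis by (simp add: \<beta>_def)
qed

section \<open>Asymptotics\<close>

lemma whp_regularI:
  assumes "\<forall>\<^sub>F n in sequentially. n \<in> N \<longrightarrow>
      measure_pmf.prob (random_regular_graph n (d n)) {E. real (sum_number {1..n} E) < k n} \<le> exp (- real n)"
  shows "whp_regular N d (\<lambda>n E. real (sum_number {1..n} E) \<ge> k n)"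
proof -
  define F where "F = inf sequentially (principal N)"
  define p where "p = (\<lambda>n. measure_pmf.prob (random_regular_graph n (d n)) {E. real (sum_number {1..n} E) \<ge> k n})"
  have compl: "p n = 1 - measure_pmf.prob (random_regular_graph n (d n)) {E. real (sum_number {1..n} E) < k n}" for n
  proof -
    have "{E. real (sum_number {1..n} E) \<ge> k n} = UNIV - {E. real (sum_number {1..n} E) < k n}" by auto
    then show ?thesis
      unfolding p_def
      using measure_pmf.prob_compl[of "{E. real (sum_number {1..n} E) < k n}" "random_regular_graph n (d n)"] by simp
  qed
  have "(p \<longlongrightarrow> 1) F"
  proof (rule tendsto_sandwich)
    show "\<forall>\<^sub>F n in F. 1 - exp (- real n) \<le> p n"
      unfolding F_def eventually_inf_principal using assms by eventually_elim (auto simp: compl)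
    show "\<forall>\<^sub>F n in F. p n \<le> 1" by (simp add: p_def)
    have "((\<lambda>n :: nat. 1 - exp (- real n)) \<longlongrightarrow> 1) sequentially" by real_asymp
    then show "((\<lambda>n :: nat. 1 - exp (- real n)) \<longlongrightarrow> 1) F"
      unfolding F_def by (rule tendsto_mono[rotated]) simp
  qed simp
  then show ?thesis by (simp add: whp_regular_def p_def F_def)
qed

text \<open>The radius is chosen as \<open>s\<close> about \<open>(ln n)^2\<close>. The roots then
  contribute only \<open>n ln ln n / ln n\<close>, up to a constant, to the exponent, and the lower
  bound on \<open>k\<close> ensures \<open>s \<le> K\<close>. The quantifiers over \<open>d\<close>,
  \<open>k\<close> and \<open>Z\<close> stand inside, so that the threshold for \<open>n\<close> is
  uniform.\<close>

lemma prob_small_sum_number_exp_bound: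
  "\<forall>\<^sub>F n in sequentially. \<forall>d k Z. 3 \<le> d \<longrightarrow> d < n \<longrightarrow> even (d * n) \<longrightarrow>
     (ln (real n))\<^sup>2 + 2 \<le> k \<longrightarrow> k < real n \<longrightarrow> 1 \<le> Z \<longrightarrow>
     2 * real (n choose 2) * (real n * real d / 2) / (real (n choose 2) - real n * real d / 2 + 1) \<le> Z \<longrightarrow>
     measure_pmf.prob (random_regular_graph n d) {E. real (sum_number {1..n} E) < k}
       \<le> exp (real n * (5 + ln (real d + 1) + ln Z) + 27 * ln (real n) * ln (ln (real n)) * k
            + real n * real d / 2 * ln (k / real n))"
proof -
  have "\<forall>\<^sub>F n :: nat in sequentially. ln (32 * ((ln (real n))\<^sup>2 + 1) + 26) \<le> 3 * ln (ln (real n))" by real_asymp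
  moreover have "\<forall>\<^sub>F n :: nat in sequentially. 27 * ln (ln (real n)) / ln (real n) \<le> 1 / 4" by real_asymp
  moreover have "\<forall>\<^sub>F n :: nat in sequentially. 3 * ln (real n) \<le> real n / 4" by real_asymp
  moreover have "\<forall>\<^sub>F n :: nat in sequentially. 1 \<le> ln (ln (real n))" by real_asymp
  moreover have "\<forall>\<^sub>F n :: nat in sequentially. 1 \<le> ln (real n)" by real_asymp
  ultimately show ?thesis
  proof eventually_elim
    case (elim n)
    show ?case
    proof (intro allI impI)
      fix d k Z
      assume d: "3 \<le> d" "d < n" and ev: "even (d * n)"
        and k: "(ln (real n))\<^sup>2 + 2 \<le> k" "k < real n" and Z1: "1 \<le> (Z :: real)"
        and Z2: "2 * real (n choose 2) * (real n * real d / 2) / (real (n choose 2) - real n * real d / 2 + 1) \<le> Z"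
      define L where "L = ln (real n)"
      have L: "1 \<le> L" "1 \<le> ln L" "ln (32 * (L\<^sup>2 + 1) + 26) \<le> 3 * ln L" "27 * ln L / L \<le> 1 / 4" "3 * L \<le> real n / 4"
        using elim by (auto simp: L_def)
      have n: "n \<ge> 4" using d by simp
      obtain m where m: "n * d = 2 * m" using ev by (auto simp: mult.commute elim: evenE)
      then have mr: "real m = real n * real d / 2"
        by (metis nonzero_mult_div_cancel_left of_nat_mult of_nat_numeral zero_neq_numeral)
      define s where "s = nat \<lceil>L\<^sup>2\<rceil>"
      define K where "K = nat \<lfloor>k\<rfloor>"
      have k0: "k > 0" using k(1) by (smt (verit) zero_le_power2)
      have s: "L\<^sup>2 \<le> real s" "real s \<le> L\<^sup>2 + 1" unfolding s_def
        by (simp_all add: real_nat_ceiling_ge)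
      have K: "real K \<le> k" "k < real K + 1" using k0 by (auto simp: K_def)
      have sK: "s \<le> K" using s K k by (simp add: L_def)
      have Kn: "K \<le> n - 1" using K k n by linarith
      define l where "l = nat \<lceil>3 * (real K + real n / real (s + 1)) * ln (32 * real s + 26)\<rceil>"
      have lnpos: "ln (32 * real s + 26) \<ge> 0" by simp
      have l1: "3 * (real K + real n / real (s + 1)) * ln (32 * real s + 26) \<le> real l"
        unfolding l_def by (rule real_nat_ceiling_ge)
      have "real l \<le> 3 * (real K + real n / real (s + 1)) * ln (32 * real s + 26) + 1"
      proof -
        have "real (nat \<lceil>x\<rceil>) \<le> x + 1" if "0 \<le> x" for x :: real
          using that of_int_ceiling_le_add_one[of x] by simp
        then show ?thesis unfolding l_def using lnpos by auto
      qed
      also have "\<dots> \<le> 3 * (k + real n / L\<^sup>2) * (3 * ln L) + 1"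
      proof (intro add_right_mono mult_mono add_mono mult_left_mono K(1))
        show "real n / real (s + 1) \<le> real n / L\<^sup>2" using s L by (intro divide_left_mono) auto
        have "ln (32 * real s + 26) \<le> ln (32 * (L\<^sup>2 + 1) + 26)" using s by (subst ln_le_cancel_iff) auto
        then show "ln (32 * real s + 26) \<le> 3 * ln L" using L by simp
      qed (use L k0 in auto)
      finally have l2: "real l \<le> 9 * ln L * (k + real n / L\<^sup>2) + 1" by (simp add: mult_ac)
      define X where "X = {E. real (sum_number {1..n} E) < k}"
      have "X \<subseteq> {E. sum_number {1..n} E \<le> K}" using k0 by (auto simp: X_def K_def le_nat_floor)
      then have "measure_pmf.prob (random_regular_graph n d) X
          \<le> measure_pmf.prob (random_regular_graph n d) {E. sum_number {1..n} E \<le> K}"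
        by (intro measure_pmf.finite_measure_mono) auto
      also have "\<dots> \<le> (exp 1 * (real d + 1)) ^ n * (4 ^ n * (real (n ^ 2 * K + 1) ^ l * ((real K / real (n - 1)) ^ m * Z ^ n)))"
      proof (rule prob_small_sum_number_le[OF d m sK Kn l1 Z1])
        have "real ((n choose 2) - m + 1) = real (n choose 2) - real m + 1"
          using regular_edges_le[OF d(2) m] by (simp add: of_nat_diff)
        then show "2 * real (n choose 2) * real m / real ((n choose 2) - m + 1) \<le> Z"
          using Z2 by (simp only: mr)
      qed
      also have "\<dots> \<le> exp (real n * (1 + ln (real d + 1))) * (exp (real n * 2) *
          (exp (real l * (3 * L)) * (exp (real m * ln (k / real n) + real n) * exp (real n * ln Z))))"
      proof (intro mult_mono)
        show "(exp 1 * (real d + 1)) ^ n \<le> exp (real n * (1 + ln (real d + 1)))"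
          by (simp add: exp_of_nat_mult exp_add)
        have "(2 :: real) \<le> exp 1" using exp_ge_add_one_self[of 1] by simp
        then have "(2 :: real) * 2 \<le> exp 1 * exp 1" by (intro mult_mono) auto
        then have "(4 :: real) \<le> exp 2" by (simp add: exp_add[symmetric])
        then show "(4 :: real) ^ n \<le> exp (real n * 2)" by (simp add: exp_of_nat_mult power_mono)
        have "n ^ 2 * K + 1 \<le> n ^ 3"
        proof -
          have "n ^ 2 * K + 1 \<le> n ^ 2 * (n - 1) + n ^ 2" using Kn n by (intro add_mono mult_left_mono) auto
          also have "\<dots> = n ^ 2 * ((n - 1) + 1)" by (simp only: distrib_left mult_1_right)
          also have "\<dots> = n ^ 3" using n by (simp add: power2_eq_square power3_eq_cube)
          finally show ?thesis .
        qed
        then have "real (n ^ 2 * K + 1) \<le> real (n ^ 3)" by (rule of_nat_mono)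
        also have "\<dots> = exp (3 * L)"
          using n exp_of_nat_mult[of 3 L] by (simp add: L_def)
        finally show "real (n ^ 2 * K + 1) ^ l \<le> exp (real l * (3 * L))"
          unfolding exp_of_nat_mult by (intro power_mono) auto
        \<comment> \<open>Replacing \<open>n - 1\<close> by \<open>n\<close> costs a factor of at
          most \<open>exp (m / (n - 1))\<close>, and \<open>m / (n - 1) \<le> n / 2\<close> because
          \<open>d \<le> n - 1\<close>.\<close>
        show "(real K / real (n - 1)) ^ m \<le> exp (real m * ln (k / real n) + real n)"
        proof -
          have n1: "real (n - 1) > 0" using n by simp
          have "ln (real n / real (n - 1)) \<le> real n / real (n - 1) - 1" using n by (intro ln_le_minus_one) auto
          also have "\<dots> = 1 / real (n - 1)" using n by (simp add: field_simps of_nat_diff)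
          finally have "real m * ln (real n / real (n - 1)) \<le> real m * (1 / real (n - 1))"
            by (intro mult_left_mono) auto
          also have "\<dots> = real n * real d / (2 * real (n - 1))" by (simp add: mr)
          also have "\<dots> \<le> real n * real (n - 1) / (2 * real (n - 1))"
            using d n1 by (intro divide_right_mono mult_left_mono) auto
          also have "\<dots> = real n / 2" using n1 by (simp del: of_nat_diff)
          also have "\<dots> \<le> real n" by simp
          finally have 1: "real m * ln (real n / real (n - 1)) \<le> real n" .
          have "(real K / real (n - 1)) ^ m \<le> (k / real (n - 1)) ^ m"
            using K n1 by (intro power_mono divide_right_mono) auto
          also have "\<dots> = exp (real m * ln (k / real (n - 1)))"
            using k0 n1 by (simp add: exp_of_nat_mult)
          also have "ln (k / real (n - 1)) = ln (k / real n) + ln (real n / real (n - 1))"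
            using k0 n n1 by (subst ln_mult_pos[symmetric]) auto
          also have "exp (real m * (ln (k / real n) + ln (real n / real (n - 1)))) \<le> exp (real m * ln (k / real n) + real n)"
            using 1 by (simp add: distrib_left)
          finally show ?thesis .
        qed
        show "Z ^ n \<le> exp (real n * ln Z)" using Z1 by (simp add: exp_of_nat_mult)
      qed (use Z1 in auto)
      also have "\<dots> = exp (real n * (1 + ln (real d + 1)) + (real n * 2 + (real l * (3 * L) + ((real m * ln (k / real n) + real n) + real n * ln Z))))"
        by (simp only: exp_add)
      also have "\<dots> \<le> exp (real n * (5 + ln (real d + 1) + ln Z) + 27 * L * ln L * k + real n * real d / 2 * ln (k / real n))"
      proof -
        \<comment> \<open>The constant 27 is a product of three factors 3: from the bound for
          dissociated sets, from the logarithm of the norm bound, and from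
          \<open>n ^ 2 * K + 1 \<le> n ^ 3\<close>. The root and rounding terms take
          \<open>n / 4\<close> each.\<close>
        have "real l * (3 * L) \<le> (9 * ln L * (k + real n / L\<^sup>2) + 1) * (3 * L)"
          using l2 L by (intro mult_right_mono) auto
        also have "\<dots> = 27 * L * ln L * k + real n * (27 * ln L / L) + 3 * L"
          using L by (simp add: field_simps power2_eq_square)
        also have "\<dots> \<le> 27 * L * ln L * k + real n * (1 / 4) + real n / 4"
          using L by (intro add_mono mult_left_mono) auto
        finally have "real l * (3 * L) \<le> 27 * L * ln L * k + real n / 2" by simp
        then show ?thesis by (simp add: mr algebra_simps)
      qed
      finally show "measure_pmf.prob (random_regular_graph n d) {E. real (sum_number {1..n} E) < k}
         \<le> exp (real n * (5 + ln (real d + 1) + ln Z) + 27 * ln (real n) * ln (ln (real n)) * k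
            + real n * real d / 2 * ln (k / real n))"
        by (simp add: X_def L_def)
    qed
  qed
qed

section \<open>The price of a tree edge in terms of the density\<close>

lemma real_choose_two: "real (n choose 2) = real n * (real n - 1) / 2"
  by (cases n) (auto simp: choose_two real_of_nat_div field_simps)

text \<open>For \<open>2 * d < n\<close> at most half of all pairs are edges, so the denominator is
  at least half of the number of pairs.\<close>

lemma density_factor_le:
  assumes "0 < d" "2 * d < n"
  shows "2 * real (n choose 2) * (real n * real d / 2) / (real (n choose 2) - real n * real d / 2 + 1) \<le> 2 * real n * real d"
proof -
  define N where "N = real (n choose 2)"
  have "real n * (2 * real d) \<le> real n * (real n - 1)" using assms by (intro mult_left_mono) auto
  then have le: "real n * real d \<le> N" by (simp add: N_def real_choose_two)
  have N: "N > 0" using assms le by (smt (verit) mult_pos_pos of_nat_0_less_iff zero_less_iff_neq_zero less_nat_zero_code)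
  have "2 * N * (real n * real d / 2) / (N - real n * real d / 2 + 1) \<le> 2 * N * (real n * real d / 2) / (N / 2)"
    using le N by (intro divide_left_mono mult_pos_pos) auto
  also have "\<dots> = 2 * real n * real d" using N by simp
  finally show ?thesis by (simp add: N_def)
qed

text \<open>The denominator is at least 1 even for the complete graph. The resulting
  \<open>ln Z \<le> 4 * ln n\<close> is affordable for large degrees.\<close>

lemma density_factor_le_crude:
  assumes "0 < d" "d < n"
  shows "2 * real (n choose 2) * (real n * real d / 2) / (real (n choose 2) - real n * real d / 2 + 1) \<le> real n ^ 4"
proof -
  define N where "N = real (n choose 2)"
  have "real n * real d \<le> real n * (real n - 1)" using assms by (intro mult_left_mono) auto
  then have le: "real n * real d / 2 \<le> N" by (simp add: N_def real_choose_two)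
  have "2 * N \<le> real n * real n" by (simp add: N_def real_choose_two algebra_simps)
  moreover have "0 \<le> N" by (simp add: N_def)
  ultimately have N: "0 \<le> N" "2 * N \<le> real n * real n" by auto
  have "2 * N * (real n * real d / 2) / (N - real n * real d / 2 + 1) \<le> 2 * N * (real n * real d / 2) / 1"
    using le N by (intro divide_left_mono) auto
  also have "\<dots> = 2 * N * (real n * real d / 2)" by simp
  also have "\<dots> \<le> real n * real n * (real n * real n)"
  proof (rule mult_mono[OF N(2)])
    have "real n * real d \<le> real n * real n" using assms by (intro mult_left_mono) auto
    then show "real n * real d / 2 \<le> real n * real n" using zero_le_square[of "real n"] by linarith
  qed auto
  finally show ?thesis by (simp add: N_def power4_eq_xxxx mult_ac)
qed

section \<open>The sparse range of degrees\<close>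

definition sparse_gap :: "nat \<Rightarrow> real" where
  "sparse_gap n = max (2 * ln (ln (ln (real n))) / ln (ln (real n))) (1 / (real n + 1))"

text \<open>The second entry of the maximum serves only positivity for small \<open>n\<close>, where
  iterated logarithms may be meaningless; the first is what the estimate for large \<open>n\<close>
  uses.\<close>

lemma sparse_gap_pos: "sparse_gap n > 0"
  by (simp add: sparse_gap_def less_max_iff_disj)

lemma sparse_gap_tendsto_0: "sparse_gap \<longlonglongrightarrow> 0"
proof -
  have "(\<lambda>n :: nat. 2 * ln (ln (ln (real n))) / ln (ln (real n))) \<longlonglongrightarrow> 0" by real_asymp
  moreover have "(\<lambda>n :: nat. 1 / (real n + 1)) \<longlonglongrightarrow> 0" by real_asymp
  ultimately have "sparse_gap \<longlonglongrightarrow> max 0 0" unfolding sparse_gap_def by (rule tendsto_max)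
  then show ?thesis by simp
qed

text \<open>At \<open>k\<close> of order \<open>n powr (1 - 2 / d)\<close> the gain
  \<open>(n * d / 2) * ln (n / k)\<close> contains the term \<open>n * ln n\<close>, which balances
  the \<open>n * ln n\<close> hidden in \<open>n * ln Z\<close>. The constant
  \<open>exp (- 26)\<close> contributes a further \<open>13 * n * d\<close> that absorbs the
  rest.\<close>

lemma sparse_sum_number:
  "\<forall>\<^sub>F n in sequentially. \<forall>d. 3 \<le> d \<longrightarrow> d < n \<longrightarrow> even (d * n) \<longrightarrow>
     real d \<le> (2 - sparse_gap n) * ln (real n) / ln (ln (real n)) \<longrightarrow>
     measure_pmf.prob (random_regular_graph n d)
       {E. real (sum_number {1..n} E) < exp (- 26) * real n powr (1 - 2 / real d)} \<le> exp (- real n)"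
proof -
  have "\<forall>\<^sub>F n :: nat in sequentially. 1 \<le> ln (ln (ln (real n)))" by real_asymp
  moreover have "\<forall>\<^sub>F n :: nat in sequentially. 1 \<le> ln (ln (real n))" by real_asymp
  moreover have "\<forall>\<^sub>F n :: nat in sequentially. 1 \<le> ln (real n)" by real_asymp
  \<comment> \<open>The exponent \<open>1 - 2 / d\<close> is at least 1/3 for
    \<open>d \<ge> 3\<close>.\<close>
  moreover have "\<forall>\<^sub>F n :: nat in sequentially. (ln (real n))\<^sup>2 + 2 \<le> exp (- 26) * real n powr (1 / 3)" by real_asymp
  moreover have "\<forall>\<^sub>F n :: nat in sequentially. 4 * ln (real n) < real n" by real_asymp
  ultimately show ?thesis
    using prob_small_sum_number_exp_bound
  proof eventually_elim
    case (elim n)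
    show ?case
    proof (intro allI impI)
      fix d assume d: "3 \<le> d" "d < n" "even (d * n)"
        and dle: "real d \<le> (2 - sparse_gap n) * ln (real n) / ln (ln (real n))"
      define L where "L = ln (real n)"
      define M where "M = ln L"
      define B where "B = ln M"
      have L: "1 \<le> L" "1 \<le> M" "1 \<le> B" "L\<^sup>2 + 2 \<le> exp (- 26) * real n powr (1 / 3)" "4 * L < real n"
        using elim by (auto simp: L_def M_def B_def)
      have n: "real n > 0" "n \<ge> 1" using d by auto
      define k where "k = exp (- 26) * real n powr (1 - 2 / real d)"
      have "(2 - sparse_gap n) * (L / M) \<le> (2 - 2 * B / M) * (L / M)"
        using L by (intro mult_right_mono) (auto simp: sparse_gap_def L_def M_def B_def)
      then have dle': "real d \<le> (2 - 2 * B / M) * (L / M)" using dle by (simp add: L_def M_def)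
      have BM: "B \<le> M" unfolding B_def using L ln_le_minus_one[of M] by simp
      \<comment> \<open>The gap is tailored to this product:
        \<open>(2 - 2 * B / M) * (L / M) * (M + B)\<close> equals
        \<open>2 * L * (1 - (B / M)^2)\<close>. Exponentiating gives
        \<open>L * M \<le> n powr (2 / d)\<close>, which keeps the encoding cost
        \<open>27 * L * M * k\<close> below \<open>n\<close>.\<close>
      have "real d * (M + B) \<le> (2 - 2 * B / M) * (L / M) * (M + B)"
        using dle' L by (intro mult_right_mono) auto
      also have "\<dots> = 2 * L - 2 * L * (B\<^sup>2 / M\<^sup>2)"
        using L by (simp add: field_simps power2_eq_square)
      also have "\<dots> \<le> 2 * L" using L by simp
      finally have dMB: "M + B \<le> 2 / real d * L" using d by (simp add: field_simps)
      have npow: "real n powr (2 / real d) = exp (2 / real d * L)" using n by (simp add: powr_def L_def)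
      have "L > 0" "M > 0" using L by auto
      then have "exp M = L" "exp B = M" unfolding B_def by (simp_all only: exp_ln M_def)
      then have "L * M = exp (M + B)" by (simp add: exp_add)
      also have "\<dots> \<le> real n powr (2 / real d)" unfolding npow using dMB by simp
      finally have LM: "L * M \<le> real n powr (2 / real d)" .
      have k_eq: "k = exp (- 26) * real n / real n powr (2 / real d)"
        using n by (simp add: k_def powr_diff)
      have LMk: "27 * L * M * k \<le> real n"
      proof -
        have "(27 :: real) \<le> exp 26" using exp_ge_add_one_self[of 26] by simp
        then have c: "27 * exp (- 26 :: real) \<le> 1" by (simp add: exp_minus field_simps)
        have "27 * L * M * k = 27 * exp (- 26) * real n * (L * M / real n powr (2 / real d))"
          by (simp add: k_eq)
        also have "\<dots> \<le> 1 * real n * 1"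
          using c LM n L by (intro mult_mono) auto
        finally show ?thesis by simp
      qed
      have "real d \<le> 2 * L"
      proof -
        have "real d * 1 \<le> real d * (M + B)" using L by (intro mult_left_mono) auto
        also have "\<dots> \<le> 2 * L" using dMB d by (simp add: field_simps)
        finally show ?thesis by simp
      qed
      then have dn: "2 * d < n" using L by linarith
      have klt: "k < real n"
      proof -
        have "real n powr (1 - 2 / real d) \<le> real n powr 1" using n by (intro powr_mono) auto
        then have "k \<le> exp (- 26) * real n" using n by (simp add: k_def)
        also have "\<dots> < 1 * real n" using n by (intro mult_strict_right_mono) auto
        finally show ?thesis by simp
      qed
      have kge: "L\<^sup>2 + 2 \<le> k"
      proof -
        have "real n powr (1 / 3) \<le> real n powr (1 - 2 / real d)" using n d by (intro powr_mono) (auto simp: field_simps)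
        then show ?thesis using L(4) by (auto simp: k_def intro: order_trans)
      qed
      have ln_k: "ln (k / real n) = - 26 - 2 / real d * L"
      proof -
        have "k / real n = exp (- 26 - 2 / real d * L)"
          using n by (simp add: k_eq npow exp_diff)
        then show ?thesis by simp
      qed
      define Z where "Z = 2 * real n * real d"
      have Z1: "1 \<le> Z"
      proof -
        have "1 * 1 \<le> real n * real d" using d n by (intro mult_mono) auto
        then show ?thesis by (simp add: Z_def)
      qed
      have "ln Z = ln 2 + L + ln (real d)" using n d by (simp add: Z_def ln_mult L_def)
      moreover have "ln (real d) \<le> real d" "ln (real d + 1) \<le> real d"
        using d ln_le_minus_one[of "real d"] ln_le_minus_one[of "real d + 1"] by auto
      ultimately have lnZ: "5 + ln (real d + 1) + ln Z \<le> 4 * real d + L"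
        using ln_2_less_1 d by simp
      have "measure_pmf.prob (random_regular_graph n d) {E. real (sum_number {1..n} E) < k}
       \<le> exp (real n * (5 + ln (real d + 1) + ln Z) + 27 * L * M * k + real n * real d / 2 * ln (k / real n))"
        unfolding M_def L_def
        by (rule elim(6)[rule_format, OF d kge[unfolded L_def] klt Z1])
          (use density_factor_le[OF _ dn] d in \<open>simp add: Z_def\<close>)
      also have "\<dots> \<le> exp (real n * (4 * real d + L) + real n + real n * real d / 2 * ln (k / real n))"
        using mult_left_mono[OF lnZ, of "real n"] LMk by simp
      \<comment> \<open>The logarithm term is \<open>- 13 * n * d - n * L\<close>; its second part
        cancels the \<open>n * L\<close>.\<close>
      also have "real n * (4 * real d + L) + real n + real n * real d / 2 * ln (k / real n) = real n * (1 - 9 * real d)"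
        using d by (simp add: ln_k field_simps)
      also have "exp (real n * (1 - 9 * real d)) \<le> exp (real n * (- 1))"
        using d by (intro iffD2[OF exp_le_cancel_iff] mult_left_mono) auto
      finally show "measure_pmf.prob (random_regular_graph n d)
       {E. real (sum_number {1..n} E) < exp (- 26) * real n powr (1 - 2 / real d)} \<le> exp (- real n)"
        by (simp add: k_def)
    qed
  qed
qed

section \<open>The dense range of degrees\<close>

lemma mult_ln_le_imp_le:
  fixes w y :: real
  assumes "0 < w" "1 \<le> y" "w * ln w \<le> y * ln y"
  shows "w \<le> y"
proof (rule ccontr)
  assume "\<not> w \<le> y"
  then have "0 \<le> ln y" "ln y < ln w" using assms by auto
  then have "y * ln y \<le> y * ln w" "y * ln w < w * ln w"
    using assms \<open>\<not> w \<le> y\<close> by (auto intro!: mult_left_mono mult_strict_right_mono)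
  then show False using assms(3) by linarith
qed

text \<open>The constant \<open>C = 2 + \<delta>\<close> works. With \<open>k = n / w\<close> the
  equation for \<open>w\<close> turns the gain into \<open>n * L * X\<close>, while the encoding
  cost is at most \<open>n * 27 * M * X\<close>, of smaller order. What remains is to make
  \<open>X\<close> large enough against \<open>ln (d + 1) + ln Z\<close>.\<close>

lemma dense_sum_number:
  fixes \<delta> :: real
  assumes \<delta>: "\<delta> > 0"
  shows "\<forall>\<^sub>F n in sequentially. \<forall>d. 3 \<le> d \<longrightarrow> d < n \<longrightarrow> even (d * n) \<longrightarrow>
     real d > (2 + \<delta>) * ln (real n) / ln (ln (real n)) \<longrightarrow>
     measure_pmf.prob (random_regular_graph n d)
       {E. real (sum_number {1..n} E) < real n / w_sol (2 + \<delta>) n d} \<le> exp (- real n)"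
proof -
  define C where "C = 2 + \<delta>"
  have C: "C > 2" "C = 2 + \<delta>" using \<delta> by (auto simp: C_def)
  have "\<forall>\<^sub>F n :: nat in sequentially. 1 \<le> ln (ln (real n))" by real_asymp
  moreover have "\<forall>\<^sub>F n :: nat in sequentially. 1 \<le> ln (real n)" by real_asymp
  moreover have "\<forall>\<^sub>F n :: nat in sequentially. 54 * ln (ln (real n)) \<le> ln (real n)" by real_asymp
  moreover have "\<forall>\<^sub>F n :: nat in sequentially. ((ln (real n))\<^sup>2 + 2) * (C * ln (real n)) \<le> real n" by real_asymp
  moreover have "\<forall>\<^sub>F n :: nat in sequentially. 4 * ln (real n) < real n" by real_asymp
  moreover have "\<forall>\<^sub>F n :: nat in sequentially.
      6 + 2 * ln (ln (real n) + 1) + ln (real n) + (27 * ln (ln (real n)) - ln (real n)) * (C / 2) \<le> - 1"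
    using C(1) by real_asymp
  moreover have "\<forall>\<^sub>F n :: nat in sequentially. 1 \<le> C * ln (real n) / 40" using C(1) by real_asymp
  moreover have "\<forall>\<^sub>F n :: nat in sequentially. C * ln (real n) \<le> C * ln (real n) / 40 * ln (C * ln (real n) / 40)"
    using C(1) by real_asymp
  moreover have "\<forall>\<^sub>F n :: nat in sequentially. 5 + 5 * ln (real n) + (27 * ln (ln (real n)) - ln (real n)) * 20 \<le> - 1"
    by real_asymp
  ultimately show ?thesis
    using prob_small_sum_number_exp_bound
  proof eventually_elim
    case (elim n)
    show ?case
    proof (intro allI impI)
      fix d assume d: "3 \<le> d" "d < n" "even (d * n)"
        and dge: "real d > (2 + \<delta>) * ln (real n) / ln (ln (real n))"
      define L where "L = ln (real n)"
      define M where "M = ln L"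
      have L: "1 \<le> L" "1 \<le> M" "54 * M \<le> L" "(L\<^sup>2 + 2) * (C * L) \<le> real n" "4 * L < real n"
        "6 + 2 * ln (L + 1) + L + (27 * M - L) * (C / 2) \<le> - 1"
        "1 \<le> C * L / 40" "C * L \<le> C * L / 40 * ln (C * L / 40)"
        "5 + 5 * L + (27 * M - L) * 20 \<le> - 1"
        using elim by (auto simp: L_def M_def)
      have n: "real n > 0" "n \<ge> 2" using d by auto
      have rd: "real d > 0" using d by simp
      define w where "w = w_sol C n d"
      have w: "w > 0" "w * ln w = C * L\<^sup>2 / real d"
        unfolding w_def L_def using C n d by (intro w_sol; simp)+
      have wlnw: "w * ln w > 0" unfolding w(2) using C L rd by simp
      have w1: "w > 1" using wlnw w(1) by (simp add: zero_less_mult_iff)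
      define X where "X = C * L / (2 * w)"
      define k where "k = real n / w"
      have gain: "real n * real d / 2 * ln (k / real n) = - (real n * (L * X))"
      proof -
        have "ln (k / real n) = - ln w" using n w1 by (simp add: k_def ln_div)
        moreover have "ln w = C * L\<^sup>2 / (real d * w)" using w rd by (simp add: field_simps)
        ultimately have "ln (k / real n) = - (C * L\<^sup>2 / (real d * w))" by simp
        then show ?thesis unfolding X_def using rd w by (simp only:) (simp add: field_simps power2_eq_square)
      qed
      have cost: "27 * L * M * k \<le> real n * (27 * M * X)"
      proof -
        have "27 * L * M * k = real n * (27 * M * (L / w))" by (simp add: k_def)
        also have "\<dots> \<le> real n * (27 * M * X)"
        proof (intro mult_left_mono)
          show "L / w \<le> X" using C L w by (simp add: X_def field_simps)
        qed (use L n in auto)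
        finally show ?thesis .
      qed
      \<comment> \<open>The lower bound on \<open>d\<close> enters here and yields
        \<open>w \<le> L\<close> by monotonicity.\<close>
      have dwL: "C * L\<^sup>2 / real d \<le> L * ln L"
      proof -
        have "C * L / M < real d" using dge by (simp add: C_def L_def M_def)
        then have "C * L < real d * M" using L by (simp add: field_simps)
        then have "L * (C * L) \<le> L * (real d * M)" using L by (intro mult_left_mono) auto
        then show ?thesis using rd by (simp add: M_def field_simps power2_eq_square)
      qed
      have wL: "w \<le> L" by (rule mult_ln_le_imp_le) (use w dwL L in auto)
      have kge: "L\<^sup>2 + 2 \<le> k"
      proof -
        have "(L\<^sup>2 + 2) * w \<le> (L\<^sup>2 + 2) * (C * L)"
        proof (intro mult_left_mono)
          have "1 * L \<le> C * L" using C L by (intro mult_right_mono) auto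
          then show "w \<le> C * L" using wL by simp
        qed auto
        then show ?thesis using L(4) w by (simp add: k_def field_simps)
      qed
      have klt: "k < real n" using w1 n by (simp add: k_def field_simps)
      have bound: "measure_pmf.prob (random_regular_graph n d) {E. real (sum_number {1..n} E) < k}
         \<le> exp (real n * (5 + ln (real d + 1) + ln Z + (27 * M - L) * X))"
        if "1 \<le> Z" "2 * real (n choose 2) * (real n * real d / 2) / (real (n choose 2) - real n * real d / 2 + 1) \<le> Z" for Z
      proof -
        have "measure_pmf.prob (random_regular_graph n d) {E. real (sum_number {1..n} E) < k}
           \<le> exp (real n * (5 + ln (real d + 1) + ln Z) + 27 * L * M * k + real n * real d / 2 * ln (k / real n))"
          unfolding M_def L_def
          by (rule elim(10)[rule_format, OF d kge[unfolded L_def] klt that])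
        also have "\<dots> \<le> exp (real n * (5 + ln (real d + 1) + ln Z) + real n * (27 * M * X) + - (real n * (L * X)))"
          unfolding gain using cost by simp
        also have "\<dots> = exp (real n * (5 + ln (real d + 1) + ln Z + (27 * M - L) * X))"
          by (simp add: algebra_simps)
        finally show ?thesis .
      qed
      have neg: "27 * M - L \<le> 0" using L by simp
      have "measure_pmf.prob (random_regular_graph n d) {E. real (sum_number {1..n} E) < k} \<le> exp (real n * (- 1))"
      proof (cases "real d \<le> L")
        case True
        have dn: "2 * d < n" using True L by linarith
        have Z1: "1 \<le> 2 * real n * real d"
        proof -
          have "1 * 1 \<le> real n * real d" using d n by (intro mult_mono) auto
          then show ?thesis by simp
        qed
        \<comment> \<open>For \<open>d \<le> L\<close> the price \<open>ln Z\<close> is only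
          \<open>L\<close> up to lower order, and the gain \<open>L * X\<close> beats it because
          \<open>C / 2 > 1\<close>.\<close>
        have "C / 2 \<le> X"
        proof -
          have "C * w \<le> C * L" using wL C(1) by (intro mult_left_mono) auto
          then show ?thesis using w(1) by (simp add: X_def le_divide_eq)
        qed
        then have "(27 * M - L) * X \<le> (27 * M - L) * (C / 2)" using neg by (rule mult_left_mono_neg)
        moreover have "ln (2 * real n * real d) \<le> 1 + L + ln (L + 1)"
        proof -
          have "ln (2 * real n * real d) = ln 2 + L + ln (real d)" using n rd by (simp add: ln_mult L_def)
          moreover have "ln (real d) \<le> ln (L + 1)" using True rd by (subst ln_le_cancel_iff) auto
          ultimately show ?thesis using ln_2_less_1 by simp
        qed
        moreover have "ln (real d + 1) \<le> ln (L + 1)" using True rd by (subst ln_le_cancel_iff) auto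
        ultimately have "5 + ln (real d + 1) + ln (2 * real n * real d) + (27 * M - L) * X \<le> - 1" using L(6) by simp
        then have "exp (real n * (5 + ln (real d + 1) + ln (2 * real n * real d) + (27 * M - L) * X)) \<le> exp (real n * (- 1))"
          by (intro iffD2[OF exp_le_cancel_iff] mult_left_mono) auto
        moreover have "0 < d" using d by simp
        ultimately show ?thesis using bound[OF Z1 density_factor_le[OF _ dn]] by linarith
      next
        case False
        have Z1: "1 \<le> real n ^ 4" using n by simp
        \<comment> \<open>For \<open>d > L\<close> the solution \<open>w\<close> is of order less
          than \<open>L\<close>. The bound \<open>w \<le> C * L / 40\<close> gives
          \<open>X \<ge> 20\<close>, far more than the \<open>5 * L\<close> of all logarithmic
          prices requires.\<close>
        have "C * L\<^sup>2 / real d \<le> C * L"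
        proof -
          have "C * L * L \<le> C * L * real d" using False C L by (intro mult_left_mono) auto
          then show ?thesis using rd by (simp add: field_simps power2_eq_square)
        qed
        then have "w * ln w \<le> C * L / 40 * ln (C * L / 40)" using w(2) L(8) by linarith
        then have "w \<le> C * L / 40" by (rule mult_ln_le_imp_le[OF w(1) L(7)])
        then have "20 \<le> X" using w(1) by (simp add: X_def le_divide_eq)
        then have "(27 * M - L) * X \<le> (27 * M - L) * 20" using neg by (rule mult_left_mono_neg)
        moreover have "ln (real d + 1) \<le> L" unfolding L_def using d by (subst ln_le_cancel_iff) auto
        moreover have "ln (real n ^ 4) = 4 * L" using n by (simp add: ln_realpow L_def)
        ultimately have "5 + ln (real d + 1) + ln (real n ^ 4) + (27 * M - L) * X \<le> - 1" using L(9) by simp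
        then have "exp (real n * (5 + ln (real d + 1) + ln (real n ^ 4) + (27 * M - L) * X)) \<le> exp (real n * (- 1))"
          by (intro iffD2[OF exp_le_cancel_iff] mult_left_mono) auto
        moreover have "0 < d" using d by simp
        ultimately show ?thesis using bound[OF Z1 density_factor_le_crude[OF _ d(2)]] by linarith
      qed
      then show "measure_pmf.prob (random_regular_graph n d)
         {E. real (sum_number {1..n} E) < real n / w_sol (2 + \<delta>) n d} \<le> exp (- real n)"
        by (simp add: k_def w_def C_def)
    qed
  qed
qed

text \<open>The witnesses are \<open>sparse_gap\<close>, \<open>exp (- 26)\<close> and
  \<open>2 + \<delta>\<close>. They can be chosen before \<open>d\<close> and \<open>N\<close>
  because both probability bounds hold uniformly in the degree once \<open>n\<close> is
  large.\<close>

theorem theorem3p1: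
  shows
   "(\<exists>\<delta> :: nat \<Rightarrow> real. \<exists>c :: real. (\<forall>n. \<delta> n > 0) \<and> \<delta> \<longlonglongrightarrow> 0 \<and> c > 0 \<and>
      (\<forall>(d :: nat \<Rightarrow> nat) (N :: nat set).
         infinite N \<longrightarrow>
         (\<forall>n\<in>N. 3 \<le> d n \<and> d n < n \<and> even (d n * n)) \<longrightarrow>
         (\<forall>n\<in>N. real (d n) \<le> (2 - \<delta> n) * ln (real n) / ln (ln (real n))) \<longrightarrow>
         whp_regular N d
           (\<lambda>n E. real (sum_number {1..n} E) \<ge> c * real n powr (1 - 2 / real (d n)))))
    \<and>
    (\<forall>\<delta> :: real. \<delta> > 0 \<longrightarrow> (\<exists>C :: real. C > 0 \<and>
      (\<forall>(d :: nat \<Rightarrow> nat) (N :: nat set).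
         infinite N \<longrightarrow>
         (\<forall>n\<in>N. 3 \<le> d n \<and> d n < n \<and> even (d n * n)) \<longrightarrow>
         (\<forall>n\<in>N. real (d n) > (2 + \<delta>) * ln (real n) / ln (ln (real n))) \<longrightarrow>
         whp_regular N d
           (\<lambda>n E. real (sum_number {1..n} E) \<ge> real n / w_sol C n (d n)))))"
proof (intro conjI allI impI)
  show "\<exists>\<delta> :: nat \<Rightarrow> real. \<exists>c :: real. (\<forall>n. \<delta> n > 0) \<and> \<delta> \<longlonglongrightarrow> 0 \<and> c > 0 \<and>
      (\<forall>(d :: nat \<Rightarrow> nat) (N :: nat set).
         infinite N \<longrightarrow>
         (\<forall>n\<in>N. 3 \<le> d n \<and> d n < n \<and> even (d n * n)) \<longrightarrow>
         (\<forall>n\<in>N. real (d n) \<le> (2 - \<delta> n) * ln (real n) / ln (ln (real n))) \<longrightarrow>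
         whp_regular N d
           (\<lambda>n E. real (sum_number {1..n} E) \<ge> c * real n powr (1 - 2 / real (d n))))"
  proof (intro exI[of _ sparse_gap] exI[of _ "exp (- 26)"] conjI allI impI)
    fix d :: "nat \<Rightarrow> nat" and N :: "nat set"
    assume d: "\<forall>n\<in>N. 3 \<le> d n \<and> d n < n \<and> even (d n * n)"
      "\<forall>n\<in>N. real (d n) \<le> (2 - sparse_gap n) * ln (real n) / ln (ln (real n))"
    show "whp_regular N d (\<lambda>n E. real (sum_number {1..n} E) \<ge> exp (- 26) * real n powr (1 - 2 / real (d n)))"
      by (rule whp_regularI, rule eventually_mono[OF sparse_sum_number]) (use d in blast)
  qed (simp_all add: sparse_gap_pos sparse_gap_tendsto_0)
next
  fix \<delta> :: real assume \<delta>: "\<delta> > 0"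
  show "\<exists>C :: real. C > 0 \<and>
      (\<forall>(d :: nat \<Rightarrow> nat) (N :: nat set).
         infinite N \<longrightarrow>
         (\<forall>n\<in>N. 3 \<le> d n \<and> d n < n \<and> even (d n * n)) \<longrightarrow>
         (\<forall>n\<in>N. real (d n) > (2 + \<delta>) * ln (real n) / ln (ln (real n))) \<longrightarrow>
         whp_regular N d
           (\<lambda>n E. real (sum_number {1..n} E) \<ge> real n / w_sol C n (d n)))"
  proof (intro exI[of _ "2 + \<delta>"] conjI allI impI)
    fix d :: "nat \<Rightarrow> nat" and N :: "nat set"
    assume d: "\<forall>n\<in>N. 3 \<le> d n \<and> d n < n \<and> even (d n * n)"
      "\<forall>n\<in>N. real (d n) > (2 + \<delta>) * ln (real n) / ln (ln (real n))"
    show "whp_regular N d (\<lambda>n E. real (sum_number {1..n} E) \<ge> real n / w_sol (2 + \<delta>) n (d n))"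
      by (rule whp_regularI, rule eventually_mono[OF dense_sum_number[OF \<delta>]]) (use d in blast)
  qed (use \<delta> in simp)
qed

end
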